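(* Let $\hat\theta$ be an M-estimator for $\theta_0$ under some distribution $P_{\theta_0}$, with objective $J_n(\theta)=\mathbb E_n f_\theta(X)$, $\theta\in\Theta$ (to be maximized), where $(\Theta,d)$ is a metric space and $\theta_0\in\Theta$. Let $J(\theta)=\mathbb E f_\theta(X)$, and suppose the objective satisfies the following conditions (M-estimator consistency conditions): (a) for any sequence $(\theta_n)$ in $\Theta$, $\liminf_n J(\theta_n)\ge J(\theta_0)$ implies $d(\theta_n,\theta_0)\to0$; (b) $\sup_{\theta\in\Theta}|J_n(\theta)-J(\theta)|\to0$ in (outer) probability, and the estimator satisfies $J_n(\hat\theta_n)=\sup_{\theta\in\Theta}J_n(\theta)-o_P(1)$. Suppose there is a sequence of constants $c_n\to c_0\ge0$ such that $c_n n\to\infty$, and (random) thresholds $T^{(n)}\in\mathcal T$ with $c_nT^{(n)}\to T$ in probability. Suppose $\Phi=\{f_\theta\}_\theta$ and $\mathcal T$ satisfy: $\Phi$ is a BUEI-class; $\mathcal T$ is a class of threshold functions with finite VC-dimension; there is $\epsilon>0$ with $F(t(x)|x)>\epsilon$ for all $t\in\mathcal T$ and all $x$; and both classes are uniformly bounded. Then the Horvitz-Thompson estimate of the objective, $\hat J_n(\theta,T^{(n)})$, yields a consistent estimator $\hat\theta^{(n)}_{T^{(n)}}$ of $\theta_0$; that is, if $\hat\theta^{(n)}_{T^{(n)}}$ (nearly) maximizes $\theta\mapsto\hat J_n(\theta,T^{(n)})$, i.e. attains its supremum up to $o_P(1)$, then $\hat\theta^{(n)}_{T^{(n)}}\to\theta_0$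 in probability.
   Context: $X_1,X_2,\dots$ are i.i.d. draws from a distribution $P_x$ (here $P_{\theta_0}$). Each point $X_i$ has a priority $R_i$ with conditional CDF $F(\cdot|X_i)$ depending only on $X_i$, the pairs $(X_i,R_i)$ being i.i.d. A threshold is a function $t$ of a data point; point $X_i$ is sampled if $R_i<t(X_i)$. $\mathbb E_n$ denotes the empirical mean over the first $n$ pairs: $\mathbb E_n g=n^{-1}\sum_{i=1}^n g(X_i,R_i)$. The Horvitz-Thompson estimate of the objective with threshold $t$ is $$\hat J_n(\theta,t)=\mathbb E_n\, f_\theta(X)\,w(R,t(X)),\qquad w(R_i,t(X_i))=\frac{1(R_i<t(X_i))}{F(t(X_i)|X_i)}.$$ For a random threshold $T^{(n)}$, the value $\hat J_n(\theta,T^{(n)})$ is obtained by substituting $t=T^{(n)}$. A class $\mathcal G$ of functions with envelope $G(x)=\sup_{g\in\mathcal G}|g(x)|$ is a BUEI-class if it has bounded uniform entropy integral: $\int_0^1\sup_Q\sqrt{\log N(\varepsilon\|G\|_{Q,2},\mathcal G,L_2(Q))}\,d\varepsilon<\infty$, the supremum being over finitely supported probability measures $Q$ with $\|G\|_{Q,2}>0$ and $N$ denoting covering numbers. The VC-dimension of a class of real functions is that of its class of subgraphs. Usual measurability conditions of empirical process theory are implicit.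
   Formalization: F(r|x) is taken as P(R<r | X=x), the actual sampling probability, instead of P(R≤r | X=x); the two agree unless the threshold value is an atom of the priority's conditional law, in which case the claim with the usual CDF is false. *)

theory Defs
  imports "HOL-Probability.Probability"
begin

section \<open>Convergence in outer probability\<close>

definition outer_prob :: "'w measure \<Rightarrow> 'w set \<Rightarrow> real" where
  "outer_prob M A = (INF B\<in>{B \<in> sets M. A \<subseteq> B}. measure M B)"

text \<open>No measurability of the variables is required; if they are measurable, this is ordinary
  convergence in probability.\<close>

definition tendsto_outer_prob ::
    "'w measure \<Rightarrow> (nat \<Rightarrow> 'w \<Rightarrow> real) \<Rightarrow> ('w \<Rightarrow> real) \<Rightarrow> bool" where
  "tendsto_outer_prob M Y Z \<longleftrightarrow>
     (\<forall>\<delta>>0. (\<lambda>n. outer_prob M {\<omega> \<in> space M. \<bar>Y n \<omega> - Z \<omega>\<bar> > \<delta>}) \<longlonglongrightarrow> 0)"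

section \<open>Function classes\<close>

definition uniformly_bounded :: "'x set \<Rightarrow> ('x \<Rightarrow> real) set \<Rightarrow> bool" where
  "uniformly_bounded S \<G> \<longleftrightarrow> (\<exists>B. \<forall>g\<in>\<G>. \<forall>x\<in>S. \<bar>g x\<bar> \<le> B)"

text \<open>The supremum is taken in the reals, so this is the envelope only for classes that are
  pointwise bounded.\<close>

definition envelope :: "('x \<Rightarrow> real) set \<Rightarrow> 'x \<Rightarrow> real" where
  "envelope \<G> x = (SUP g\<in>\<G>. \<bar>g x\<bar>)"

definition L2_norm :: "'x pmf \<Rightarrow> ('x \<Rightarrow> real) \<Rightarrow> real" where
  "L2_norm Q g = sqrt (measure_pmf.expectation Q (\<lambda>x. (g x)\<^sup>2))"

text \<open>The minimal number of open balls of radius \<open>\<delta>\<close> that cover the class. The centres need not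
  belong to the class. If there is no finite cover, the infimum is over the empty set and
  equals \<open>\<infinity>\<close>.\<close>

definition covering_number :: "real \<Rightarrow> ('x \<Rightarrow> real) set \<Rightarrow> 'x pmf \<Rightarrow> enat" where
  "covering_number \<delta> \<G> Q =
     (INF C\<in>{C. finite C \<and> (\<forall>g\<in>\<G>. \<exists>h\<in>C. L2_norm Q (\<lambda>x. g x - h x) < \<delta>)}. enat (card C))"

definition sqrt_log :: "enat \<Rightarrow> ennreal" where
  "sqrt_log N = (case N of enat k \<Rightarrow> ennreal (sqrt (ln (real k))) | \<infinity> \<Rightarrow> \<infinity>)"

definition BUEI_class :: "'x set \<Rightarrow> ('x \<Rightarrow> real) set \<Rightarrow> bool" where
  "BUEI_class S \<G> \<longleftrightarrow>
     (\<integral>\<^sup>+ \<epsilon>\<in>{0<..<1}.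
        (SUP Q\<in>{Q. finite (set_pmf Q) \<and> set_pmf Q \<subseteq> S \<and> L2_norm Q (envelope \<G>) > 0}.
           sqrt_log (covering_number (\<epsilon> * L2_norm Q (envelope \<G>)) \<G> Q)) \<partial>lborel) < \<infinity>"

definition shatters :: "'a set set \<Rightarrow> 'a set \<Rightarrow> bool" where
  "shatters \<C> A \<longleftrightarrow> (\<forall>B\<subseteq>A. \<exists>C\<in>\<C>. C \<inter> A = B)"

definition VC_dim :: "'a set set \<Rightarrow> enat" where
  "VC_dim \<C> = (SUP A\<in>{A. finite A \<and> shatters \<C> A}. enat (card A))"

definition subgraph :: "'x set \<Rightarrow> ('x \<Rightarrow> real) \<Rightarrow> ('x \<times> real) set" where
  "subgraph S g = {(x, s). x \<in> S \<and> s < g x}"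

definition VC_dim_fun :: "'x set \<Rightarrow> ('x \<Rightarrow> real) set \<Rightarrow> enat" where
  "VC_dim_fun S \<G> = VC_dim (subgraph S ` \<G>)"

text \<open>The usual measurability condition under which suprema of symmetrized empirical processes over
  an uncountable class can be handled (a ``\<open>P\<close>-measurable class'', van der Vaart and Wellner,
  Weak Convergence and Empirical Processes, Definition 2.3.3).\<close>

definition P_measurable_class :: "'z measure \<Rightarrow> ('z \<Rightarrow> real) set \<Rightarrow> bool" where
  "P_measurable_class P \<H> \<longleftrightarrow>
     \<H> \<subseteq> borel_measurable P \<and>
     (\<forall>n (e :: nat \<Rightarrow> real).
        (\<lambda>z. SUP h\<in>\<H>. \<bar>\<Sum>i<n. e i * h (z i)\<bar>)
          \<in> borel_measurable (completion (Pi\<^sub>M {..<n} (\<lambda>_. P))))"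

section \<open>Threshold sampling\<close>

text \<open>\<open>K x\<close> is the conditional law of a priority given the data point \<open>x\<close>. A point is sampled when
  its priority is strictly below the threshold, and inverse probability weighting divides by the
  probability of that event. Hence the distribution function is taken in the convention
  \<open>F(r|x) = P(R < r | X = x)\<close>. It agrees with \<open>P(R \<le> r | X = x)\<close> unless \<open>r\<close> is an atom.\<close>

definition cond_cdf :: "('x \<Rightarrow> real measure) \<Rightarrow> real \<Rightarrow> 'x \<Rightarrow> real" where
  "cond_cdf K r x = measure (K x) {..<r}"

lemma cond_cdf_eq_cdf:
  assumes "finite_borel_measure (K x)" and "isCont (cdf (K x)) r"
  shows "cond_cdf K r x = cdf (K x) r"
proof -
  interpret finite_borel_measure "K x" by fact
  have "measure (K x) {r} = 0"
    using assms(2) isCont_cdf by blast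
  moreover have "measure (K x) ({..<r} \<union> {r}) = measure (K x) {..<r} + measure (K x) {r}"
    by (rule finite_measure_Union) auto
  moreover have "{..<r} \<union> {r} = {..r}" by auto
  ultimately show ?thesis by (simp add: cond_cdf_def cdf_def)
qed

definition HT_weight :: "('x \<Rightarrow> real measure) \<Rightarrow> ('x \<Rightarrow> real) \<Rightarrow> 'x \<Rightarrow> real \<Rightarrow> real" where
  "HT_weight K t x r = of_bool (r < t x) / cond_cdf K (t x) x"

definition emp_mean ::
    "(nat \<Rightarrow> 'w \<Rightarrow> 'x) \<Rightarrow> (nat \<Rightarrow> 'w \<Rightarrow> real) \<Rightarrow> nat \<Rightarrow> ('x \<Rightarrow> real \<Rightarrow> real) \<Rightarrow> 'w \<Rightarrow> real" where
  "emp_mean X R n g \<omega> = (\<Sum>i<n. g (X i \<omega>) (R i \<omega>)) / real n"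

definition emp_objective ::
    "(nat \<Rightarrow> 'w \<Rightarrow> 'x) \<Rightarrow> (nat \<Rightarrow> 'w \<Rightarrow> real) \<Rightarrow> ('p \<Rightarrow> 'x \<Rightarrow> real) \<Rightarrow> nat \<Rightarrow> 'p \<Rightarrow> 'w \<Rightarrow> real" where
  "emp_objective X R f n \<theta> = emp_mean X R n (\<lambda>x r. f \<theta> x)"

definition HT_objective ::
    "(nat \<Rightarrow> 'w \<Rightarrow> 'x) \<Rightarrow> (nat \<Rightarrow> 'w \<Rightarrow> real) \<Rightarrow> ('x \<Rightarrow> real measure) \<Rightarrow> ('p \<Rightarrow> 'x \<Rightarrow> real) \<Rightarrow>
      nat \<Rightarrow> 'p \<Rightarrow> ('x \<Rightarrow> real) \<Rightarrow> 'w \<Rightarrow> real" where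
  "HT_objective X R K f n \<theta> t = emp_mean X R n (\<lambda>x r. f \<theta> x * HT_weight K t x r)"

definition limit_objective :: "'x measure \<Rightarrow> ('p \<Rightarrow> 'x \<Rightarrow> real) \<Rightarrow> 'p \<Rightarrow> real" where
  "limit_objective P f \<theta> = (\<integral>x. f \<theta> x \<partial>P)"

text \<open>The pairs \<open>(X i, R i)\<close> are independent, each \<open>X i\<close> has law \<open>P\<close>, and the conditional law of
  \<open>R i\<close> given \<open>X i = x\<close> is \<open>K x\<close>. The last condition fixes the joint law of each pair, so the
  pairs are identically distributed.\<close>

definition iid_priority_sample ::
    "'w measure \<Rightarrow> 'x measure \<Rightarrow> ('x \<Rightarrow> real measure) \<Rightarrow>
      (nat \<Rightarrow> 'w \<Rightarrow> 'x) \<Rightarrow> (nat \<Rightarrow> 'w \<Rightarrow> real) \<Rightarrow> bool" where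
  "iid_priority_sample M P K X R \<longleftrightarrow>
     prob_space M \<and>
     K \<in> P \<rightarrow>\<^sub>M prob_algebra borel \<and>
     prob_space.indep_vars M (\<lambda>_. P \<Otimes>\<^sub>M borel) (\<lambda>i \<omega>. (X i \<omega>, R i \<omega>)) UNIV \<and>
     (\<forall>i. distr M P (X i) = P) \<and>
     (\<forall>i. \<forall>A\<in>sets P. \<forall>B\<in>sets borel.
        emeasure M {\<omega> \<in> space M. X i \<omega> \<in> A \<and> R i \<omega> \<in> B} = (\<integral>\<^sup>+x\<in>A. emeasure (K x) B \<partial>P))"

end

theory Submission
  imports Defs "HOL-Real_Asymp.Real_Asymp"
begin

text \<open>The estimator is an argmax of the objective \<open>HT_objective\<close>, whose expectation for every fixed
  threshold is the limit objective, since the weight has conditional mean 1 given the data point.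
  By well-separatedness it is therefore enough that the weighted objective converges uniformly over
  all parameters \<^emph>\<open>and all thresholds\<close> of the class.

  The uniform law follows from a bound on the empirical \<open>L\<^sub>1\<close> covering numbers of the weighted class.
  The factor \<open>f \<theta>\<close> is covered, uniformly in the sample, because the entropy integral is finite. For
  the weight, the sampling indicator and the discretized inclusion probability are both monotone
  transforms of the value of the threshold, so a Sauer--Shelah count leaves only polynomially many
  patterns on a sample. A ghost sample, sign changes and an exponential moment bound then show that
  the expected supremum of the empirical process is \<open>o(n)\<close>.\<close>

section \<open>Shattering\<close>

text \<open>The threshold may depend on the whole sample, so the summands of the weighted objective
  at \<open>Tn n \<omega>\<close> need not be independent; a law that is uniform over
  \<open>\<T>\<close> makes the substitution harmless. Two obstacles shape that law. The weight
  jumps in the threshold, so closeness of thresholds does not control it: thresholds are instead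
  grouped by exact agreement of finitely many monotone tests on the sample, after which only the
  inclusion probabilities can differ, by at most 1/m. Moreover, suprema over an uncountable class
  are measurable only in the form granted by \<open>P_measurable_class\<close>, with one sample and
  one coefficient vector. Hence sample and ghost sample form a single sample of 2n points with
  coefficients 1 and -1, and sign changes are realised by permuting the coordinates of the product
  measure rather than by additional random variables. The number of cover elements may grow with n,
  since the exponential bound absorbs any subexponential growth.\<close>

text \<open>Pajor's form of the Sauer-Shelah lemma. Removing \<open>a\<close> leaves the traces
  \<open>\<F>0\<close> and, counted a second time, the traces \<open>\<F>1\<close> that extend both
  with and without \<open>a\<close>. What \<open>\<F>0\<close> shatters is shattered by
  \<open>\<F>\<close>; what \<open>\<F>1\<close> shatters stays shattered by \<open>\<F>\<close>
  after adding \<open>a\<close>. The two kinds of shattered sets are disjoint because only the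
  second contains \<open>a\<close>.\<close>

lemma card_le_card_shattered:
  assumes "finite I" "\<F> \<subseteq> Pow I"
  shows "card \<F> \<le> card {J. J \<subseteq> I \<and> shatters \<F> J}"
  using assms
proof (induction I arbitrary: \<F> rule: finite_induct)
  case empty
  show ?case
  proof (cases "\<F> = {}")
    case False
    with empty have "\<F> = {{}}" by auto
    moreover have "{J. J \<subseteq> {} \<and> shatters \<F> J} = {{}}"
      using calculation by (auto simp: shatters_def)
    ultimately show ?thesis by simp
  qed simp
next
  case (insert a I)
  define Sh where "Sh = (\<lambda>\<G>. {J. J \<subseteq> I \<and> shatters \<G> J})"
  \<comment> \<open>\<open>\<G>\<close> and \<open>\<H>\<close> split the family by membership of
    \<open>a\<close>, with \<open>a\<close> removed; their union and intersection are
    \<open>\<F>0\<close> and \<open>\<F>1\<close>, which gives the count by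
    inclusion-exclusion.\<close>
  define \<F>0 where "\<F>0 = {F. F \<subseteq> I \<and> (F \<in> \<F> \<or> insert a F \<in> \<F>)}"
  define \<F>1 where "\<F>1 = {F. F \<subseteq> I \<and> F \<in> \<F> \<and> insert a F \<in> \<F>}"
  define \<G> where "\<G> = {F \<in> \<F>. a \<notin> F}"
  define \<H> where "\<H> = {F. F \<subseteq> I \<and> insert a F \<in> \<F>}"
  have fin: "finite (Pow (insert a I))" using insert by simp
  have fin': "finite (Pow I)" using insert by simp
  have Gfin: "finite \<G>" "finite \<H>"
    using insert fin by (auto simp: \<G>_def \<H>_def intro: finite_subset[of _ \<F>] finite_subset[of _ "Pow (insert a I)"])
  have Gsub: "\<G> \<subseteq> Pow I" using insert by (auto simp: \<G>_def)
  have split: "\<F> = \<G> \<union> insert a ` \<H>"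
  proof (intro equalityI subsetI)
    fix F assume F: "F \<in> \<F>"
    show "F \<in> \<G> \<union> insert a ` \<H>"
    proof (cases "a \<in> F")
      case True
      then have "F = insert a (F - {a})" by auto
      moreover have "F - {a} \<subseteq> I" using F insert.prems by auto
      ultimately show ?thesis using F unfolding \<H>_def by (metis (mono_tags, lifting) UnI2 image_eqI mem_Collect_eq)
    qed (use F in \<open>auto simp: \<G>_def\<close>)
  qed (auto simp: \<G>_def \<H>_def)
  have inj: "inj_on (insert a) (Pow I)"
    using insert.hyps by (auto simp: inj_on_def)
  have "card \<F> = card \<G> + card (insert a ` \<H>)"
    by (subst split, rule card_Un_disjoint) (use Gfin in \<open>auto simp: \<G>_def\<close>)
  also have "card (insert a ` \<H>) = card \<H>"
    by (rule card_image) (rule inj_on_subset[OF inj], auto simp: \<H>_def)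
  also have "card \<G> + card \<H> = card (\<G> \<union> \<H>) + card (\<G> \<inter> \<H>)"
    by (rule card_Un_Int[OF Gfin])
  also have "\<G> \<union> \<H> = \<F>0" using Gsub insert.hyps by (auto simp: \<G>_def \<H>_def \<F>0_def)
  also have "\<G> \<inter> \<H> = \<F>1" using Gsub insert.hyps by (auto simp: \<G>_def \<H>_def \<F>1_def)
  also have "card \<F>0 + card \<F>1 \<le> card (Sh \<F>0) + card (Sh \<F>1)"
    unfolding Sh_def by (intro add_mono insert.IH) (auto simp: \<F>0_def \<F>1_def)
  also have "\<dots> = card (Sh \<F>0) + card (insert a ` Sh \<F>1)"
    by (subst card_image) (auto intro: inj_on_subset[OF inj] simp: Sh_def)
  also have "\<dots> = card (Sh \<F>0 \<union> insert a ` Sh \<F>1)"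
    by (rule card_Un_disjoint[symmetric]) (use insert.hyps in \<open>auto simp: Sh_def\<close>)
  also have "\<dots> \<le> card {J. J \<subseteq> insert a I \<and> shatters \<F> J}"
  proof (rule card_mono)
    show "finite {J. J \<subseteq> insert a I \<and> shatters \<F> J}"
      using fin by (rule rev_finite_subset) auto
    have "shatters \<F> J" if J: "J \<subseteq> I" "shatters \<F>0 J" for J
      unfolding shatters_def
    proof (intro allI impI)
      fix B assume "B \<subseteq> J"
      then obtain F where F: "F \<in> \<F>0" "F \<inter> J = B" using J(2) unfolding shatters_def by meson
      have "insert a F \<inter> J = B" using F(2) J(1) insert.hyps by auto
      then show "\<exists>C\<in>\<F>. C \<inter> J = B" using F by (auto simp: \<F>0_def)
    qed
    moreover have "shatters \<F> (insert a J)" if J: "J \<subseteq> I" "shatters \<F>1 J" for J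
      unfolding shatters_def
    proof (intro allI impI)
      fix B assume B: "B \<subseteq> insert a J"
      then have "B - {a} \<subseteq> J" by auto
      then obtain F where F: "F \<in> \<F>1" "F \<inter> J = B - {a}" using J(2) unfolding shatters_def by meson
      have F': "F \<in> \<F>" "insert a F \<in> \<F>" "a \<notin> F" using F(1) insert.hyps by (auto simp: \<F>1_def)
      show "\<exists>C\<in>\<F>. C \<inter> insert a J = B"
      proof (cases "a \<in> B")
        case True
        then have "insert a F \<inter> insert a J = B" using F(2) B by auto
        then show ?thesis using F' by blast
      next
        case False
        then have "F \<inter> insert a J = B" using F(2) F'(3) by auto
        then show ?thesis using F' by blast
      qed
    qed
    ultimately show "Sh \<F>0 \<union> insert a ` Sh \<F>1 \<subseteq> {J. J \<subseteq> insert a I \<and> shatters \<F> J}"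
      by (auto simp: Sh_def)
  qed
  finally show ?case .
qed

text \<open>Counting lists instead of sets is crude but avoids binomial sums; only polynomial growth
  in \<open>card I\<close> for fixed \<open>d\<close> matters.\<close>

lemma card_subsets_card_le:
  assumes "finite I"
  shows "card {J. J \<subseteq> I \<and> card J \<le> d} \<le> (d + 1) * (card I + 1) ^ d"
proof -
  let ?L = "{xs. set xs \<subseteq> I \<and> length xs \<le> d}"
  have "{J. J \<subseteq> I \<and> card J \<le> d} \<subseteq> set ` ?L"
  proof
    fix J assume "J \<in> {J. J \<subseteq> I \<and> card J \<le> d}"
    moreover from this obtain xs where "set xs = J" "distinct xs"
      using assms by (metis finite_distinct_list finite_subset mem_Collect_eq)
    ultimately show "J \<in> set ` ?L" by (auto simp: distinct_card[symmetric])
  qed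
  then have "card {J. J \<subseteq> I \<and> card J \<le> d} \<le> card ?L"
    using finite_lists_length_le[OF assms] by (metis (lifting) surj_card_le)
  also have "\<dots> = (\<Sum>i\<le>d. card I ^ i)" by (rule card_lists_length_le[OF assms])
  also have "\<dots> \<le> (\<Sum>i\<le>d. (card I + 1) ^ d)"
  proof (rule sum_mono)
    fix i assume "i \<in> {..d}"
    then have "(card I + 1) ^ i \<le> (card I + 1) ^ d" by (intro power_increasing) auto
    moreover have "card I ^ i \<le> (card I + 1) ^ i" by (intro power_mono) auto
    ultimately show "card I ^ i \<le> (card I + 1) ^ d" by linarith
  qed
  finally show ?thesis by simp
qed

lemma card_le_if_shattered_card_le:
  assumes "finite I" "\<F> \<subseteq> Pow I" and d: "\<And>J. J \<subseteq> I \<Longrightarrow> shatters \<F> J \<Longrightarrow> card J \<le> d"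
  shows "card \<F> \<le> (d + 1) * (card I + 1) ^ d"
proof -
  have "card \<F> \<le> card {J. J \<subseteq> I \<and> shatters \<F> J}"
    by (rule card_le_card_shattered) fact+
  also have "\<dots> \<le> card {J. J \<subseteq> I \<and> card J \<le> d}"
    using assms(1) d by (intro card_mono) auto
  also have "\<dots> \<le> (d + 1) * (card I + 1) ^ d"
    by (rule card_subsets_card_le[OF assms(1)])
  finally show ?thesis .
qed

lemma VC_dim_fun_finiteE:
  assumes "VC_dim_fun S \<T> < \<infinity>"
  obtains d where "\<And>A. finite A \<Longrightarrow> shatters (subgraph S ` \<T>) A \<Longrightarrow> card A \<le> d"
proof -
  obtain d where d: "VC_dim_fun S \<T> = enat d" using assms by auto
  have "card A \<le> d" if "finite A" "shatters (subgraph S ` \<T>) A" for A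
  proof -
    have "enat (card A) \<le> VC_dim_fun S \<T>"
      unfolding VC_dim_fun_def VC_dim_def using that by (intro SUP_upper) auto
    then show ?thesis by (simp add: d)
  qed
  then show thesis by (rule that)
qed

text \<open>A shattered set of indices is turned into a shattered set of points of the subgraph class:
  above \<open>x k\<close> one takes the largest value at which a witness fails the predicate \<open>\<phi> k\<close>.\<close>

lemma card_monotone_patterns_le:
  fixes \<T> :: "('x \<Rightarrow> real) set"
  assumes I: "finite I" and x: "\<And>k. k \<in> I \<Longrightarrow> x k \<in> S"
    and mono: "\<And>k r s. k \<in> I \<Longrightarrow> \<phi> k r \<Longrightarrow> r \<le> s \<Longrightarrow> \<phi> k s"
    and d: "\<And>A. finite A \<Longrightarrow> shatters (subgraph S ` \<T>) A \<Longrightarrow> card A \<le> d"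
  shows "card ((\<lambda>t. {k \<in> I. \<phi> k (t (x k))}) ` \<T>) \<le> (d + 1) * (card I + 1) ^ d"
proof (rule card_le_if_shattered_card_le[OF I])
  let ?p = "\<lambda>t. {k \<in> I. \<phi> k (t (x k))}"
  fix J assume JI: "J \<subseteq> I" and sh: "shatters (?p ` \<T>) J"
  have "\<exists>t. \<forall>B\<in>Pow J. t B \<in> \<T> \<and> ?p (t B) \<inter> J = B"
    using sh unfolding shatters_def by (intro bchoice) blast
  then obtain t where t: "\<And>B. B \<subseteq> J \<Longrightarrow> t B \<in> \<T>" "\<And>B. B \<subseteq> J \<Longrightarrow> ?p (t B) \<inter> J = B"
    by blast
  have J: "finite J" using JI I by (rule finite_subset)
  \<comment> \<open>The maximum is over a nonempty set, since \<open>B = {}\<close> always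
    qualifies. Subgraphs are strict, so the witness attaining the maximum lies outside the level,
    while monotonicity of \<open>\<phi> k\<close> pushes every witness with \<open>k \<in> B\<close>
    strictly above it.\<close>
  define l where "l k = Max ((\<lambda>B. t B (x k)) ` {B. B \<subseteq> J \<and> k \<notin> B})" for k
  have l: "l k < t B (x k) \<longleftrightarrow> k \<in> B" if k: "k \<in> J" and B: "B \<subseteq> J" for k B
  proof -
    let ?V = "(\<lambda>B. t B (x k)) ` {B. B \<subseteq> J \<and> k \<notin> B}"
    have fin: "finite ?V" using J by auto
    have phi: "\<phi> k (t B (x k)) \<longleftrightarrow> k \<in> B" if "B \<subseteq> J" for B
      using t(2)[OF that] k JI by auto
    show ?thesis
    proof
      assume "k \<in> B"
      have "v < t B (x k)" if v: "v \<in> ?V" for v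
      proof (rule ccontr)
        obtain B' where B': "B' \<subseteq> J" "k \<notin> B'" "v = t B' (x k)" using v by auto
        assume "\<not> v < t B (x k)"
        then have "\<phi> k v" using mono[of k "t B (x k)" v] phi[OF B] \<open>k \<in> B\<close> k JI by auto
        then show False using phi[OF B'(1)] B' by auto
      qed
      moreover have "?V \<noteq> {}" by auto
      ultimately show "l k < t B (x k)" using fin by (simp add: l_def)
    next
      assume "l k < t B (x k)"
      moreover have "t B (x k) \<le> l k" if "k \<notin> B"
        unfolding l_def using fin that B by (intro Max_ge) auto
      ultimately show "k \<in> B" by force
    qed
  qed
  define A where "A = (\<lambda>k. (x k, l k)) ` J"
  \<comment> \<open>Distinct indices may share a data point, so injectivity has to come from
    shattering: the witness for \<open>{k}\<close> lies above the level of \<open>k\<close> and of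
    no other index.\<close>
  have "inj_on (\<lambda>k. (x k, l k)) J"
  proof (rule inj_onI)
    fix k k' assume k: "k \<in> J" "k' \<in> J" "(x k, l k) = (x k', l k')"
    then have "k' \<in> {k}" using l[of k' "{k}"] l[of k "{k}"] by auto
    then show "k = k'" by simp
  qed
  then have "card J = card A" by (simp add: A_def card_image)
  also have "card A \<le> d"
  proof (rule d)
    show "shatters (subgraph S ` \<T>) A"
      unfolding shatters_def
    proof (intro allI impI)
      fix C assume C: "C \<subseteq> A"
      define B where "B = {k \<in> J. (x k, l k) \<in> C}"
      have B: "B \<subseteq> J" by (auto simp: B_def)
      have "(x k, l k) \<in> subgraph S (t B) \<longleftrightarrow> (x k, l k) \<in> C" if "k \<in> J" for k
        using l[OF that B] x[of k] that JI by (auto simp: subgraph_def B_def)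
      then have "subgraph S (t B) \<inter> A = C" using C by (auto simp: A_def)
      then show "\<exists>C'\<in>subgraph S ` \<T>. C' \<inter> A = C" using t(1)[OF B] by blast
    qed
  qed (simp add: A_def J)
  finally show "card J \<le> d" .
qed auto

text \<open>A gap wider than \<open>1 / m\<close> contains a grid point that tells the two numbers
  apart: round the smaller one up to the next multiple of \<open>1 / m\<close>. The range
  \<open>j \<le> m\<close> suffices because that point stays below the larger number, hence below
  1.\<close>

lemma abs_diff_le_if_same_levels:
  fixes a b :: real and m :: nat
  assumes "m > 0" "a \<in> {0..1}" "b \<in> {0..1}"
    and same: "\<And>j. j \<le> m \<Longrightarrow> j / m < a \<longleftrightarrow> j / m < b"
  shows "\<bar>a - b\<bar> \<le> 1 / m"
proof -
  have *: "v - u \<le> 1 / m"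
    if uv: "u \<in> {0..1}" "v \<in> {0..1}" and s: "\<And>j. j \<le> m \<Longrightarrow> j / m < v \<Longrightarrow> j / m < u" for u v :: real
  proof (rule ccontr)
    assume c: "\<not> v - u \<le> 1 / m"
    define j where "j = nat \<lceil>u * m\<rceil>"
    have j: "real j = of_int \<lceil>u * m\<rceil>" using uv by (simp add: j_def)
    have "real j < u * m + 1" "u * m \<le> real j" unfolding j by linarith+
    moreover have "u * m + 1 < v * m"
      using c assms(1) by (simp add: field_simps)
    ultimately have "j / m < v" "u \<le> j / m" using assms(1) by (auto simp: field_simps)
    moreover from this uv have "real j / m \<le> 1" by (auto)
    then have "j \<le> m" using assms(1) by (simp add: field_simps)
    ultimately show False using s[of j] by auto
  qed
  show ?thesis using *[of a b] *[of b a] assms by (auto simp: abs_le_iff)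
qed

section \<open>Sign averages\<close>

abbreviation signs :: "nat \<Rightarrow> (nat \<Rightarrow> real) set" where
  "signs n \<equiv> PiE {..<n} (\<lambda>_. {-1, 1})"

text \<open>This is \<open>cosh x \<le> exp (x\<^sup>2 / 2)\<close>, the sub-Gaussian bound for one
  random sign. It is the analytic inequality behind Hoeffding's lemma at probability 1/2 and
  interval length \<open>2 * x\<close>; symmetry in \<open>x\<close> reduces to
  \<open>x \<ge> 0\<close>.\<close>

lemma exp_add_exp_minus_le: "exp x + exp (- x) \<le> 2 * exp (x\<^sup>2 / 2)" for x :: real
proof -
  have *: "exp x + exp (- x) \<le> 2 * exp (x\<^sup>2 / 2)" if "x \<ge> 0" for x :: real
  proof -
    let ?y = "1 + 1 / 2 * (exp (2 * x) - 1)"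
    have y: "?y > 0" by (simp add: field_simps add_pos_pos)
    have "- (2 * x) * (1 / 2) + ln ?y \<le> (2 * x)\<^sup>2 / 8"
      using that by (intro Hoeffdings_lemma_aux) auto
    moreover have "- (2 * x) * (1 / 2) = - x" "(2 * x)\<^sup>2 / 8 = x\<^sup>2 / 2" by (simp_all add: power_mult_distrib)
    ultimately have "exp (- x + ln ?y) \<le> exp (x\<^sup>2 / 2)" by (simp only: exp_le_cancel_iff)
    moreover have "exp (- x + ln ?y) = exp (- x) * ?y" by (simp only: exp_add exp_ln[OF y])
    ultimately have "exp (- x) * ?y \<le> exp (x\<^sup>2 / 2)" by linarith
    moreover have "exp (- x) * exp (2 * x) = exp x" by (simp flip: exp_add)
    then have "exp (- x) * ?y = (exp x + exp (- x)) / 2" by (simp add: algebra_simps)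
    ultimately show ?thesis by simp
  qed
  show ?thesis using *[of x] *[of "- x"] by (cases "x \<ge> 0") (auto simp: add.commute)
qed

text \<open>Expectations over random signs are written as plain sums over the \<open>2 ^ n\<close>
  sign vectors; exchanging product and sum takes the place of independence.\<close>

lemma sum_signs_exp_le:
  assumes a: "\<And>i. i < n \<Longrightarrow> \<bar>a i\<bar> \<le> c"
  shows "(\<Sum>e\<in>signs n. exp (l * (\<Sum>i<n. e i * a i))) \<le> 2 ^ n * exp (n * (l * c)\<^sup>2 / 2)"
proof -
  have "(\<Sum>e\<in>signs n. exp (l * (\<Sum>i<n. e i * a i))) = (\<Sum>e\<in>signs n. \<Prod>i<n. exp (l * (e i * a i)))"
    by (simp add: sum_distrib_left exp_sum)
  also have "\<dots> = (\<Prod>i<n. \<Sum>b\<in>{-1, 1}. exp (l * (b * a i)))"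
    by (rule prod_sum_PiE[symmetric]) auto
  also have "\<dots> \<le> (\<Prod>i<n. 2 * exp ((l * c)\<^sup>2 / 2))"
  proof (rule prod_mono)
    fix i assume i: "i \<in> {..<n}"
    have "(a i)\<^sup>2 \<le> c\<^sup>2"
      using a[of i] i by (metis abs_ge_zero lessThan_iff power2_abs power_mono)
    then have "(l * a i)\<^sup>2 \<le> (l * c)\<^sup>2"
      by (simp add: power_mult_distrib mult_left_mono)
    then have "2 * exp ((l * a i)\<^sup>2 / 2) \<le> 2 * exp ((l * c)\<^sup>2 / 2)" by simp
    then show "0 \<le> (\<Sum>b\<in>{-1, 1}. exp (l * (b * a i))) \<and>
        (\<Sum>b\<in>{-1, 1}. exp (l * (b * a i))) \<le> 2 * exp ((l * c)\<^sup>2 / 2)"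
      using exp_add_exp_minus_le[of "l * a i"] by (auto simp: add.commute intro: order_trans)
  qed
  also have "\<dots> = 2 ^ n * exp (n * (l * c)\<^sup>2 / 2)"
    by (simp add: power_mult_distrib flip: exp_of_nat_mult)
  finally show ?thesis .
qed

text \<open>The maximal inequality rests on \<open>y \<le> s + exp (l (y - s)) / l\<close>, in which the maximum
  over the finite class may be replaced by a sum.\<close>

lemma sign_average_maximal_inequality:
  fixes a :: "'g \<Rightarrow> nat \<Rightarrow> real"
  assumes S: "finite S" and a: "\<And>g i. g \<in> S \<Longrightarrow> i < n \<Longrightarrow> \<bar>a g i\<bar> \<le> c" and l: "l > 0"
  obtains b where "\<And>e g. g \<in> S \<Longrightarrow> \<bar>\<Sum>i<n. e i * a g i\<bar> \<le> b e"
    "(\<Sum>e\<in>signs n. b e) \<le> 2 ^ n * (s + 2 * card S / l * exp (n * (l * c)\<^sup>2 / 2 - l * s))"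
proof
  define y where "y e g = (\<Sum>i<n. e i * a g i)" for e g
  \<comment> \<open>Both \<open>y e g\<close> and \<open>- y e g\<close> enter because
    \<open>b e\<close> must dominate an absolute value; this is the source of the factor 2 before
    \<open>card S\<close>. The level \<open>s\<close> is left free, to be set later so that the
    exponent becomes negative.\<close>
  define b where "b e = s + (\<Sum>g\<in>S. exp (l * (y e g - s)) + exp (l * (- y e g - s))) / l" for e
  have le: "u \<le> s + exp (l * (u - s)) / l" for u
    using exp_ge_add_one_self[of "l * (u - s)"] l by (simp add: field_simps)
  show "\<bar>\<Sum>i<n. e i * a g i\<bar> \<le> b e" if g: "g \<in> S" for e g
  proof -
    have "\<bar>y e g\<bar> \<le> s + (exp (l * (y e g - s)) + exp (l * (- y e g - s))) / l"
    proof -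
      have "exp u / l \<ge> 0" for u using l by simp
      from this[of "l * (y e g - s)"] this[of "l * (- y e g - s)"] le[of "y e g"] le[of "- y e g"]
      show ?thesis unfolding add_divide_distrib by linarith
    qed
    also have "\<dots> \<le> b e"
      unfolding b_def using l S g
      by (intro add_left_mono divide_right_mono member_le_sum[where f = "\<lambda>g. exp (l * (y e g - s)) + exp (l * (- y e g - s))"]) auto
    finally show ?thesis by (simp add: y_def)
  qed
  let ?E = "2 ^ n * exp (n * (l * c)\<^sup>2 / 2)"
  have fin: "finite (signs n)" by (intro finite_PiE) auto
  have card: "card (signs n) = 2 ^ n" by (subst card_PiE) (auto simp: numeral_2_eq_2)
  have ex: "exp (l * (u - s)) = exp (l * u) * exp (- l * s)" for u
    unfolding exp_add[symmetric] by (simp add: algebra_simps)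
  have ex': "exp (u - l * s) = exp u * exp (- l * s)" for u
    unfolding exp_add[symmetric] by simp
  have E: "(\<Sum>e\<in>signs n. exp (l * (y e g - s))) + (\<Sum>e\<in>signs n. exp (l * (- y e g - s)))
      \<le> 2 * ?E * exp (- l * s)" if g: "g \<in> S" for g
  proof -
    have "(\<Sum>e\<in>signs n. exp (l * y e g)) \<le> ?E"
      unfolding y_def by (rule sum_signs_exp_le) (rule a[OF g])
    moreover have "(\<Sum>e\<in>signs n. exp (- l * y e g)) \<le> ?E"
      unfolding y_def using sum_signs_exp_le[of n "a g" c "- l"] a[OF g] by simp
    ultimately have "((\<Sum>e\<in>signs n. exp (l * y e g)) + (\<Sum>e\<in>signs n. exp (- l * y e g))) * exp (- l * s)
        \<le> (?E + ?E) * exp (- l * s)"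
      by (intro mult_right_mono add_mono) auto
    moreover have "((\<Sum>e\<in>signs n. exp (l * y e g)) + (\<Sum>e\<in>signs n. exp (- l * y e g))) * exp (- l * s)
       = (\<Sum>e\<in>signs n. exp (l * (y e g - s))) + (\<Sum>e\<in>signs n. exp (l * (- y e g - s)))"
      by (simp only: ex distrib_right sum_distrib_right) simp
    ultimately show ?thesis by (simp only: mult_2)
  qed
  have "(\<Sum>e\<in>signs n. b e) = 2 ^ n * s +
      (\<Sum>g\<in>S. (\<Sum>e\<in>signs n. exp (l * (y e g - s))) + (\<Sum>e\<in>signs n. exp (l * (- y e g - s)))) / l"
    unfolding b_def sum.distrib sum_divide_distrib[symmetric]
    by (subst (1 2) sum.swap) (simp add: card sum.distrib add_divide_distrib)
  also have "\<dots> \<le> 2 ^ n * s + (\<Sum>g\<in>S. 2 * ?E * exp (- l * s)) / l"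
    using l E by (intro add_left_mono divide_right_mono sum_mono) auto
  also have "\<dots> = 2 ^ n * (s + 2 * card S / l * exp (n * (l * c)\<^sup>2 / 2 - l * s))"
    by (simp add: ex' distrib_left mult_ac)
  finally show "(\<Sum>e\<in>signs n. b e) \<le> \<dots>" .
qed

section \<open>Sign changes as permutations of a doubled sample\<close>

lemma sum_lessThan_add:
  fixes f :: "nat \<Rightarrow> 'a :: comm_monoid_add"
  shows "(\<Sum>i<n + m. f i) = (\<Sum>i<n. f i) + (\<Sum>i<m. f (n + i))"
  by (induction m) (simp_all add: add.assoc)

text \<open>On \<open>{..<n + n}\<close> this is the involution exchanging \<open>i\<close> and
  \<open>n + i\<close> exactly where \<open>e i\<close> is not 1. An index map is used so that a
  sign change becomes a reindexing of the product measure.\<close>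

definition swap_by :: "nat \<Rightarrow> (nat \<Rightarrow> real) \<Rightarrow> nat \<Rightarrow> nat" where
  "swap_by n e i =
     (if i < n then (if e i = 1 then i else n + i) else (if e (i - n) = 1 then i else i - n))"

lemma swap_by_in: "i < n + n \<Longrightarrow> swap_by n e i < n + n"
  by (auto simp: swap_by_def)

lemma inj_on_swap_by: "inj_on (swap_by n e) {..<n + n}"
  by (rule inj_onI) (auto simp: swap_by_def split: if_splits)

text \<open>Exchanging \<open>i\<close> and \<open>n + i\<close> negates the difference
  \<open>h i - h (n + i)\<close>, so a sum with fixed coefficients turns into one with arbitrary
  signs.\<close>

lemma sum_swap_by:
  fixes h :: "nat \<Rightarrow> real"
  assumes "e \<in> signs n"
  shows "(\<Sum>i<n + n. (if i < n then 1 else - 1) * h (swap_by n e i)) =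
    (\<Sum>i<n. e i * (h i - h (n + i)))"
proof -
  have "(\<Sum>i<n + n. (if i < n then 1 else - 1) * h (swap_by n e i)) =
      (\<Sum>i<n. h (swap_by n e i) - h (swap_by n e (n + i)))"
    by (simp add: sum_lessThan_add sum_subtractf sum_negf)
  also have "\<dots> = (\<Sum>i<n. e i * (h i - h (n + i)))"
  proof (rule sum.cong)
    fix i assume "i \<in> {..<n}"
    moreover from this have "e i = 1 \<or> e i = - 1" using assms by auto
    ultimately show "h (swap_by n e i) - h (swap_by n e (n + i)) = e i * (h i - h (n + i))"
      by (auto simp: swap_by_def)
  qed simp
  finally show ?thesis .
qed

section \<open>Symmetrization\<close>

text \<open>The majorant is needed because \<open>u\<close> is measurable for the completion only, whereas Fubini's
  theorem is applied to the uncompleted product.\<close>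

lemma completion_borel_majorant:
  fixes u :: "'a \<Rightarrow> real"
  assumes u: "u \<in> borel_measurable (completion M)" and C: "\<And>z. z \<in> space M \<Longrightarrow> u z \<le> C"
  obtains v :: "'a \<Rightarrow> real" where "v \<in> borel_measurable M" "AE z in M. v z = u z"
    "\<And>z. z \<in> space M \<Longrightarrow> u z \<le> v z"
proof -
  obtain g where g[measurable]: "g \<in> borel_measurable M" and ae: "AE z in M. u z = g z"
    using completion_ex_borel_measurable_real[OF u] by blast
  obtain N where N: "{z \<in> space M. u z \<noteq> g z} \<subseteq> N" "emeasure M N = 0" "N \<in> sets M"
    using ae by (rule AE_E)
  note N(3)[measurable]
  show thesis
  proof
    \<comment> \<open>On a measurable null set containing all disagreements the constant
      \<open>C\<close> is used, so that domination holds everywhere and not merely almost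
      everywhere.\<close>
    show "(\<lambda>z. if z \<in> N then C else g z) \<in> borel_measurable M" by measurable
    have "AE z in M. z \<notin> N" using N by (intro AE_not_in) auto
    with ae show "AE z in M. (if z \<in> N then C else g z) = u z" by eventually_elim auto
    show "u z \<le> (if z \<in> N then C else g z)" if "z \<in> space M" for z
      using N(1) C that by auto
  qed
qed

text \<open>The centred sum is the ghost-sample mean of a difference of two sums, so its modulus is
  at most the mean of the modulus over the ghost half. Permutation invariance allows averaging over
  all sign vectors; the class is then replaced by finitely many centres at cost
  \<open>\<eta>\<close>, and the maximal inequality applies to those. The measurable bound
  \<open>V\<close> stands in for the supremum of deviations, whose measurability is not
  given.\<close>

lemma symmetrization:
  fixes \<mu> :: "'z measure" and \<H> :: "('z \<Rightarrow> real) set" and n N :: nat and B l s \<eta> :: real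
  assumes \<mu>: "prob_space \<mu>" and H: "\<H> \<noteq> {}"
    and meas: "P_measurable_class \<mu> \<H>"
    and B: "\<And>h z. h \<in> \<H> \<Longrightarrow> z \<in> space \<mu> \<Longrightarrow> \<bar>h z\<bar> \<le> B"
    and l: "l > 0"
    and cover: "\<And>z. z \<in> {..<n + n} \<rightarrow> space \<mu> \<Longrightarrow>
      \<exists>S\<subseteq>\<H>. finite S \<and> card S \<le> N \<and> (\<forall>h\<in>\<H>. \<exists>g\<in>S. (\<Sum>i<n + n. \<bar>h (z i) - g (z i)\<bar>) \<le> \<eta>)"
  obtains V where "V \<in> borel_measurable (Pi\<^sub>M {..<n} (\<lambda>_. \<mu>))"
    "\<And>z h. z \<in> space (Pi\<^sub>M {..<n} (\<lambda>_. \<mu>)) \<Longrightarrow> h \<in> \<H> \<Longrightarrow>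
       ennreal \<bar>(\<Sum>i<n. h (z i)) - n * (\<integral>z. h z \<partial>\<mu>)\<bar> \<le> V z"
    "(\<integral>\<^sup>+z. V z \<partial>Pi\<^sub>M {..<n} (\<lambda>_. \<mu>))
       \<le> ennreal (\<eta> + s + 2 * N / l * exp (n * (l * (2 * B))\<^sup>2 / 2 - l * s))"
proof -
  interpret prob_space \<mu> by fact
  interpret \<mu>: product_prob_space "\<lambda>_. \<mu>" by standard
  have hm: "h \<in> borel_measurable \<mu>" if "h \<in> \<H>" for h
    using meas that by (auto simp: P_measurable_class_def)
  let ?I = "{..<n}" and ?J = "{n..<n + n}" and ?K = "{..<n + n}"
  let ?P = "Pi\<^sub>M ?K (\<lambda>_. \<mu>)"
  have IJ: "?K = ?I \<union> ?J" "?I \<inter> ?J = {}"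
    by auto
  define \<sigma> where "\<sigma> i = (if i < n then 1 else - 1 :: real)" for i
  \<comment> \<open>One sum over \<open>n + n\<close> coordinates with fixed coefficients is the
    form to which \<open>P_measurable_class\<close> applies.\<close>
  define u where "u z = (SUP h\<in>\<H>. \<bar>\<Sum>i<n + n. \<sigma> i * h (z i)\<bar>)" for z
  define b where "b = \<eta> + s + 2 * N / l * exp (n * (l * (2 * B))\<^sup>2 / 2 - l * s)"
  have bound: "\<bar>\<Sum>i<n + n. \<sigma> i * h (z i)\<bar> \<le> (n + n) * B" if "z \<in> ?K \<rightarrow> space \<mu>" "h \<in> \<H>" for z h
  proof -
    have "\<bar>\<Sum>i<n + n. \<sigma> i * h (z i)\<bar> \<le> (\<Sum>i<n + n. \<bar>\<sigma> i * h (z i)\<bar>)" by (rule sum_abs)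
    also have "\<dots> \<le> (\<Sum>i<n + n. B)"
      using that by (intro sum_mono) (auto simp: \<sigma>_def abs_mult intro!: B)
    finally show ?thesis by simp
  qed
  have u_upper: "\<bar>\<Sum>i<n + n. \<sigma> i * h (z i)\<bar> \<le> u z" if "z \<in> ?K \<rightarrow> space \<mu>" "h \<in> \<H>" for z h
    unfolding u_def using that bound[of z] by (intro cSUP_upper bdd_aboveI2) auto
  have u_le: "u z \<le> (n + n) * B" if "z \<in> space ?P" for z
    unfolding u_def using that H bound[of z] by (intro cSUP_least) (auto simp: space_PiM)
  have "u \<in> borel_measurable (completion ?P)"
    using meas unfolding P_measurable_class_def u_def[abs_def] by blast
  from completion_borel_majorant[OF this u_le]
  obtain v where v[measurable]: "v \<in> borel_measurable ?P" and v_ae: "AE z in ?P. v z = u z"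
    and uv: "\<And>z. z \<in> space ?P \<Longrightarrow> u z \<le> v z" by blast

  \<comment> \<open>Permuting coordinates preserves a product of equal factors, so the integral of
    \<open>v\<close> equals the average of the integrals of \<open>v\<close> composed with
    \<open>\<tau> e\<close>.\<close>
  define \<tau> where "\<tau> e z = (\<lambda>i\<in>?K. z (swap_by n e i))" for e and z :: "nat \<Rightarrow> 'z"
  have \<tau>[measurable]: "\<tau> e \<in> ?P \<rightarrow>\<^sub>M ?P" for e
    unfolding \<tau>_def using swap_by_in[of _ n e] by (intro measurable_restrict measurable_component_singleton) auto
  have distr_\<tau>: "distr ?P ?P (\<tau> e) = ?P" for e
    unfolding \<tau>_def[abs_def]
    using distr_PiM_reindex[of ?K "\<lambda>_. \<mu>" "swap_by n e" ?K] inj_on_swap_by[of n e] swap_by_in[of _ n e]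
    by (auto intro: prob_space_axioms)
  have u_\<tau>: "u (\<tau> e z) = (SUP h\<in>\<H>. \<bar>\<Sum>i<n. e i * (h (z i) - h (z (n + i)))\<bar>)"
    if "e \<in> signs n" for e z
  proof -
    have "(\<Sum>i<n + n. \<sigma> i * h (\<tau> e z i)) = (\<Sum>i<n. e i * (h (z i) - h (z (n + i))))" for h
      using sum_swap_by[OF that, of "\<lambda>i. h (z i)"] by (simp add: \<tau>_def \<sigma>_def)
    then show ?thesis by (simp add: u_def)
  qed
  \<comment> \<open>The point \<open>z\<close> is fixed before signs are summed, so one cover of the
    doubled sample serves all sign vectors at once.\<close>
  have u_avg: "(\<Sum>e\<in>signs n. u (\<tau> e z)) \<le> 2 ^ n * b" if z: "z \<in> space ?P" for z
  proof -
    have z': "z \<in> ?K \<rightarrow> space \<mu>" using z by (auto simp: space_PiM)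
    obtain S where S: "S \<subseteq> \<H>" "finite S" "card S \<le> N"
      and near: "\<And>h. h \<in> \<H> \<Longrightarrow> \<exists>g\<in>S. (\<Sum>i<n + n. \<bar>h (z i) - g (z i)\<bar>) \<le> \<eta>"
      using cover[OF z'] by blast
    have "\<bar>g (z i) - g (z (n + i))\<bar> \<le> 2 * B" if "g \<in> S" "i < n" for g i
    proof -
      have "z i \<in> space \<mu>" "z (n + i) \<in> space \<mu>" using z' that by auto
      with B[of g "z i"] B[of g "z (n + i)"] that S(1) show ?thesis by auto
    qed
    from sign_average_maximal_inequality[of S n "\<lambda>g i. g (z i) - g (z (n + i))" "2 * B" l s, OF S(2) this l]
    obtain b' where b': "\<And>e g. g \<in> S \<Longrightarrow> \<bar>\<Sum>i<n. e i * (g (z i) - g (z (n + i)))\<bar> \<le> b' e"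
      and sum_b': "(\<Sum>e\<in>signs n. b' e)
        \<le> 2 ^ n * (s + 2 * card S / l * exp (n * (l * (2 * B))\<^sup>2 / 2 - l * s))"
      by blast
    have "u (\<tau> e z) \<le> \<eta> + b' e" if e: "e \<in> signs n" for e
      unfolding u_\<tau>[OF e]
    proof (rule cSUP_least[OF H])
      fix h assume "h \<in> \<H>"
      then obtain g where g: "g \<in> S" "(\<Sum>i<n + n. \<bar>h (z i) - g (z i)\<bar>) \<le> \<eta>" using near by blast
      define \<Delta> where "\<Delta> i = h (z i) - g (z i)" for i
      have "(\<Sum>i<n. e i * (h (z i) - h (z (n + i)))) =
          (\<Sum>i<n. e i * (\<Delta> i - \<Delta> (n + i))) + (\<Sum>i<n. e i * (g (z i) - g (z (n + i))))"
        by (simp add: \<Delta>_def algebra_simps flip: sum.distrib)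
      moreover have "\<bar>\<Sum>i<n. e i * (\<Delta> i - \<Delta> (n + i))\<bar> \<le> (\<Sum>i<n. \<bar>\<Delta> i\<bar> + \<bar>\<Delta> (n + i)\<bar>)"
      proof (intro sum_abs[THEN order_trans] sum_mono)
        fix i assume "i \<in> {..<n}"
        then have "e i = - 1 \<or> e i = 1" using e by (auto simp: PiE_iff)
        then have "\<bar>e i\<bar> = 1" by auto
        then show "\<bar>e i * (\<Delta> i - \<Delta> (n + i))\<bar> \<le> \<bar>\<Delta> i\<bar> + \<bar>\<Delta> (n + i)\<bar>" by (simp add: abs_mult)
      qed
      \<comment> \<open>The cover measures the distance on both halves together, so a single
        \<open>\<eta>\<close> pays for the sample and its ghost.\<close>
      moreover have "(\<Sum>i<n. \<bar>\<Delta> i\<bar> + \<bar>\<Delta> (n + i)\<bar>) \<le> \<eta>"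
        using g(2) by (simp add: \<Delta>_def sum_lessThan_add sum.distrib)
      ultimately show "\<bar>\<Sum>i<n. e i * (h (z i) - h (z (n + i)))\<bar> \<le> \<eta> + b' e"
        using b'[OF g(1), of e] by linarith
    qed
    then have "(\<Sum>e\<in>signs n. u (\<tau> e z)) \<le> (\<Sum>e\<in>signs n. \<eta> + b' e)" by (rule sum_mono)
    also have "\<dots> = 2 ^ n * \<eta> + (\<Sum>e\<in>signs n. b' e)"
      by (simp add: sum.distrib card_PiE numeral_2_eq_2[symmetric])
    also have "\<dots> \<le> 2 ^ n * \<eta> + 2 ^ n * (s + 2 * N / l * exp (n * (l * (2 * B))\<^sup>2 / 2 - l * s))"
      using S(3) l by (intro add_left_mono order_trans[OF sum_b'] mult_left_mono mult_right_mono divide_right_mono) auto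
    finally show ?thesis by (simp add: b_def algebra_simps)
  qed
  have fin: "finite (signs n)" by (intro finite_PiE) auto
  have v_int: "(\<integral>\<^sup>+z. ennreal (v z) \<partial>?P) \<le> ennreal b"
  proof -
    have "2 ^ n * (\<integral>\<^sup>+z. ennreal (v z) \<partial>?P) = (\<Sum>e\<in>signs n. \<integral>\<^sup>+z. ennreal (v z) \<partial>distr ?P ?P (\<tau> e))"
      unfolding distr_\<tau> by (simp add: card_PiE numeral_2_eq_2[symmetric])
    also have "\<dots> = (\<Sum>e\<in>signs n. \<integral>\<^sup>+z. ennreal (v (\<tau> e z)) \<partial>?P)"
      by (intro sum.cong nn_integral_distr) auto
    also have "\<dots> = (\<integral>\<^sup>+z. (\<Sum>e\<in>signs n. ennreal (v (\<tau> e z))) \<partial>?P)"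
      by (rule nn_integral_sum[symmetric]) measurable
    also have "\<dots> \<le> (\<integral>\<^sup>+z. ennreal (2 ^ n * b) \<partial>?P)"
    proof (rule nn_integral_mono_AE)
      \<comment> \<open>The null set where \<open>v\<close> and \<open>u\<close> differ pulls back
        to a null set, because \<open>\<tau> e\<close> preserves the measure; there are only
        finitely many \<open>e\<close>.\<close>
      have "AE z in ?P. v (\<tau> e z) = u (\<tau> e z)" for e
      proof (rule AE_distrD[where M' = ?P])
        show "\<tau> e \<in> ?P \<rightarrow>\<^sub>M ?P" by measurable
        show "AE z in distr ?P ?P (\<tau> e). v z = u z" unfolding distr_\<tau> by (rule v_ae)
      qed
      then have "AE z in ?P. \<forall>e\<in>signs n. v (\<tau> e z) = u (\<tau> e z)"
        by (intro AE_finite_allI fin)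
      moreover have "AE z in ?P. z \<in> space ?P" by (rule AE_space)
      ultimately show "AE z in ?P. (\<Sum>e\<in>signs n. ennreal (v (\<tau> e z))) \<le> ennreal (2 ^ n * b)"
      proof eventually_elim
        case (elim z)
        have "0 \<le> u (\<tau> e z)" for e
        proof -
          obtain h where h: "h \<in> \<H>" using H by auto
          have "\<tau> e z \<in> space ?P" using \<tau> elim(2) by (rule measurable_space)
          then have "0 \<le> \<bar>\<Sum>i<n + n. \<sigma> i * h (\<tau> e z i)\<bar>" "\<tau> e z \<in> ?K \<rightarrow> space \<mu>" by (auto simp: space_PiM)
          with u_upper[OF _ h] show ?thesis by (meson order_trans)
        qed
        then have "(\<Sum>e\<in>signs n. ennreal (v (\<tau> e z))) = ennreal (\<Sum>e\<in>signs n. u (\<tau> e z))"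
          using elim(1) by (simp add: sum_ennreal)
        also have "\<dots> \<le> ennreal (2 ^ n * b)" using u_avg[OF elim(2)] by (rule ennreal_leI)
        finally show ?case .
      qed
    qed
    also have "\<dots> = ennreal (2 ^ n * b)"
      using \<mu>.P.emeasure_space_1 by (simp add: prob_space.emeasure_space_1[OF prob_space_PiM] prob_space_axioms)
    also have "\<dots> = 2 ^ n * ennreal b" by (simp add: ennreal_mult' flip: ennreal_power)
    finally show ?thesis by (subst (asm) ennreal_mult_le_mult_iff) (auto simp: power_eq_top_ennreal)
  qed
  \<comment> \<open>Only the ghost half is integrated out. \<open>V\<close> is
    \<open>ennreal\<close>-valued, so no integrability has to be checked before applying
    Fubini.\<close>
  define V where "V x = (\<integral>\<^sup>+y. ennreal (v (merge ?I ?J (x, y))) \<partial>Pi\<^sub>M ?J (\<lambda>_. \<mu>))" for x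
  interpret J: prob_space "Pi\<^sub>M ?J (\<lambda>_. \<mu>)" by (intro prob_space_PiM prob_space_axioms)
  have mv[measurable]: "(\<lambda>z. v (merge ?I ?J z)) \<in> borel_measurable (Pi\<^sub>M ?I (\<lambda>_. \<mu>) \<Otimes>\<^sub>M Pi\<^sub>M ?J (\<lambda>_. \<mu>))"
    by (rule measurable_compose[OF measurable_merge]) (use v in \<open>simp flip: IJ\<close>)
  show thesis
  proof
    show "V \<in> borel_measurable (Pi\<^sub>M ?I (\<lambda>_. \<mu>))" unfolding V_def by measurable
    show "(\<integral>\<^sup>+z. V z \<partial>Pi\<^sub>M ?I (\<lambda>_. \<mu>)) \<le> ennreal (\<eta> + s + 2 * N / l * exp (n * (l * (2 * B))\<^sup>2 / 2 - l * s))"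
      unfolding b_def[symmetric] V_def
      using v_int \<mu>.product_nn_integral_fold[OF IJ(2), of "\<lambda>z. ennreal (v z)"] v by (simp add: flip: IJ(1))
    fix z h assume z: "z \<in> space (Pi\<^sub>M ?I (\<lambda>_. \<mu>))" and h: "h \<in> \<H>"
    note hm[OF h, measurable]
    define G where "G y = (\<Sum>i<n. h (z i)) - (\<Sum>i<n. h (y (n + i)))" for y
    have int: "integrable (Pi\<^sub>M ?J (\<lambda>_. \<mu>)) (\<lambda>y. h (y (n + i)))"
        "(\<integral>y. h (y (n + i)) \<partial>Pi\<^sub>M ?J (\<lambda>_. \<mu>)) = (\<integral>z. h z \<partial>\<mu>)" if "i < n" for i
    proof -
      have i: "n + i \<in> ?J" using that by auto
      have d: "distr (Pi\<^sub>M ?J (\<lambda>_. \<mu>)) \<mu> (\<lambda>y. y (n + i)) = \<mu>" by (rule distr_PiM_component) (use i prob_space_axioms in auto)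
      have "integrable (distr (Pi\<^sub>M ?J (\<lambda>_. \<mu>)) \<mu> (\<lambda>y. y (n + i))) h"
        unfolding d using B[OF h] by (intro integrable_const_bound[of _ B]) (auto)
      then show "integrable (Pi\<^sub>M ?J (\<lambda>_. \<mu>)) (\<lambda>y. h (y (n + i)))"
        using measurable_component_singleton[OF i] by (rule integrable_distr[rotated])
      show "(\<integral>y. h (y (n + i)) \<partial>Pi\<^sub>M ?J (\<lambda>_. \<mu>)) = (\<integral>z. h z \<partial>\<mu>)"
        using i by (subst d[symmetric], subst integral_distr) auto
    qed
    have "(\<Sum>i<n. h (z i)) - n * (\<integral>z. h z \<partial>\<mu>) = (\<integral>y. G y \<partial>Pi\<^sub>M ?J (\<lambda>_. \<mu>))"
      unfolding G_def using int by (subst Bochner_Integration.integral_diff) (auto simp: J.prob_space)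
    then have "ennreal \<bar>(\<Sum>i<n. h (z i)) - n * (\<integral>z. h z \<partial>\<mu>)\<bar> = ennreal (norm (\<integral>y. G y \<partial>Pi\<^sub>M ?J (\<lambda>_. \<mu>)))"
      by simp
    also have "\<dots> \<le> (\<integral>\<^sup>+y. ennreal (norm (G y)) \<partial>Pi\<^sub>M ?J (\<lambda>_. \<mu>))"
      unfolding G_def using int by (intro integral_norm_bound_ennreal Bochner_Integration.integrable_diff
          Bochner_Integration.integrable_sum) auto
    also have "\<dots> \<le> V z"
      unfolding V_def
    proof (intro nn_integral_mono ennreal_leI)
      fix y assume y: "y \<in> space (Pi\<^sub>M ?J (\<lambda>_. \<mu>))"
      let ?m = "merge ?I ?J (z, y)"
      have m: "?m \<in> space ?P" unfolding IJ(1)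
        using z y by (auto simp: space_PiM space_pair_measure intro!: measurable_space[OF measurable_merge, unfolded space_PiM])
      have "G y = (\<Sum>i<n + n. \<sigma> i * h (?m i))"
        by (simp add: sum_lessThan_add G_def \<sigma>_def sum_negf merge_def)
      also have "\<bar>\<dots>\<bar> \<le> u ?m" using m h by (intro u_upper) (auto simp: space_PiM)
      also have "\<dots> \<le> v ?m" by (rule uv[OF m])
      finally show "norm (G y) \<le> v ?m" by simp
    qed
    finally show "ennreal \<bar>(\<Sum>i<n. h (z i)) - n * (\<integral>z. h z \<partial>\<mu>)\<bar> \<le> V z" .
  qed
qed

section \<open>Uniform laws of large numbers\<close>

context prob_space
begin

lemma outer_prob_le: "A \<subseteq> B \<Longrightarrow> B \<in> events \<Longrightarrow> outer_prob M A \<le> prob B"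
  unfolding outer_prob_def by (rule cINF_lower) (auto intro!: bdd_belowI2[of _ 0])

lemma outer_prob_nonneg: "A \<subseteq> space M \<Longrightarrow> 0 \<le> outer_prob M A"
  unfolding outer_prob_def by (rule cINF_greatest) auto

lemma outer_prob_approx:
  assumes "A \<subseteq> space M" "e > 0"
  obtains B where "B \<in> events" "A \<subseteq> B" "prob B < outer_prob M A + e"
proof -
  have "\<exists>y\<in>prob ` {B \<in> events. A \<subseteq> B}. y < outer_prob M A + e"
    using assms by (intro cInf_lessD) (auto simp: outer_prob_def)
  then show thesis using that by auto
qed

lemma outer_prob_mono: "A \<subseteq> B \<Longrightarrow> B \<subseteq> space M \<Longrightarrow> outer_prob M A \<le> outer_prob M B"
  unfolding outer_prob_def by (rule cINF_superset_mono) (auto intro!: bdd_belowI2[of _ 0])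

lemma outer_prob_Un_le:
  assumes "A \<subseteq> space M" "B \<subseteq> space M"
  shows "outer_prob M (A \<union> B) \<le> outer_prob M A + outer_prob M B"
proof (rule field_le_epsilon)
  fix e :: real assume "e > 0"
  then have e: "e / 2 > 0" by simp
  obtain A' where A': "A' \<in> events" "A \<subseteq> A'" "prob A' < outer_prob M A + e / 2"
    by (rule outer_prob_approx[OF assms(1) e])
  obtain B' where B': "B' \<in> events" "B \<subseteq> B'" "prob B' < outer_prob M B + e / 2"
    by (rule outer_prob_approx[OF assms(2) e])
  have "outer_prob M (A \<union> B) \<le> prob (A' \<union> B')" using A' B' by (intro outer_prob_le) auto
  also have "\<dots> \<le> prob A' + prob B'" using A'(1) B'(1) by (rule measure_Un_le)
  finally show "outer_prob M (A \<union> B) \<le> outer_prob M A + outer_prob M B + e" using A' B' by linarith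
qed

end

text \<open>Symmetrization followed by Markov's inequality. With \<open>s = n * \<eta>\<close> the
  exponent is \<open>n * (2 * l\<^sup>2 * B\<^sup>2 - l * \<eta>)\<close>, minimal at
  \<open>l = \<eta> / (4 * B\<^sup>2)\<close> with value
  \<open>- n * \<eta>\<^sup>2 / (8 * B\<^sup>2)\<close>. Of the three \<open>\<eta>\<close>, two
  come from covering \<open>n + n\<close> points and one from \<open>s\<close>.\<close>

lemma outer_prob_deviation_le:
  fixes \<mu> :: "'z measure" and \<H> :: "('z \<Rightarrow> real) set" and n N :: nat and B \<eta> \<delta> :: real
  assumes M: "prob_space M"
    and indep: "prob_space.indep_vars M (\<lambda>_. \<mu>') Z UNIV"
    and law: "\<And>i. distr M \<mu>' (Z i) = \<mu>"
    and H: "\<H> \<noteq> {}" and meas: "P_measurable_class \<mu> \<H>"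
    and B: "B > 0" "\<And>h z. h \<in> \<H> \<Longrightarrow> z \<in> space \<mu> \<Longrightarrow> \<bar>h z\<bar> \<le> B"
    and pos: "n > 0" "\<eta> > 0" "\<delta> > 0"
    and cover: "\<And>z. z \<in> {..<n + n} \<rightarrow> space \<mu> \<Longrightarrow>
      \<exists>S\<subseteq>\<H>. finite S \<and> card S \<le> N \<and>
        (\<forall>h\<in>\<H>. \<exists>g\<in>S. (\<Sum>i<n + n. \<bar>h (z i) - g (z i)\<bar>) \<le> real (n + n) * \<eta>)"
  shows "outer_prob M {\<omega> \<in> space M. \<exists>h\<in>\<H>. \<bar>(\<Sum>i<n. h (Z i \<omega>)) / n - (\<integral>z. h z \<partial>\<mu>)\<bar> > \<delta>}
    \<le> (3 * \<eta> + 8 * B\<^sup>2 / \<eta> * (N * exp (- (\<eta>\<^sup>2 / (8 * B\<^sup>2)) * n))) / \<delta>"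
proof -
  interpret M: prob_space M by fact
  have Z: "Z i \<in> M \<rightarrow>\<^sub>M \<mu>'" for i using indep by (auto simp: M.indep_vars_def)
  \<comment> \<open>\<open>\<mu>'\<close> serves only as the sigma-algebra in which the variables
    take values; their law is \<open>\<mu>\<close>.\<close>
  have sets: "sets \<mu> = sets \<mu>'" by (simp flip: law[of 0])
  have Z'[measurable]: "Z i \<in> M \<rightarrow>\<^sub>M \<mu>" for i using Z measurable_cong_sets[OF refl sets] by blast
  have prob: "prob_space \<mu>" unfolding law[of 0, symmetric] by (rule M.prob_space_distr) (rule Z)
  let ?P = "Pi\<^sub>M {..<n} (\<lambda>_. \<mu>)"
  define W where "W \<omega> = (\<lambda>i\<in>{..<n}. Z i \<omega>)" for \<omega>
  have W[measurable]: "W \<in> M \<rightarrow>\<^sub>M ?P" unfolding W_def by measurable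
  have W_law: "distr M ?P W = ?P"
  proof -
    have "M.indep_vars (\<lambda>_. \<mu>') Z {..<n}" using indep by (rule M.indep_vars_subset) auto
    then have "distr M (Pi\<^sub>M {..<n} (\<lambda>_. \<mu>')) W = Pi\<^sub>M {..<n} (\<lambda>i. distr M \<mu>' (Z i))"
      unfolding W_def using pos(1) Z by (subst (asm) M.indep_vars_iff_distr_eq_PiM) auto
    moreover have "distr M ?P W = distr M (Pi\<^sub>M {..<n} (\<lambda>_. \<mu>')) W"
      by (intro distr_cong sets_PiM_cong) (auto simp: sets)
    ultimately show ?thesis by (simp add: law)
  qed
  define b where "b = 3 * \<eta> + 8 * B\<^sup>2 / \<eta> * (N * exp (- (\<eta>\<^sup>2 / (8 * B\<^sup>2)) * n))"
  have b: "b > 0" using pos B by (auto simp: b_def intro!: add_pos_nonneg)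
  have l: "\<eta> / (4 * B\<^sup>2) > 0" using pos B by simp
  obtain V where V[measurable]: "V \<in> borel_measurable ?P"
    and dev: "\<And>z h. z \<in> space ?P \<Longrightarrow> h \<in> \<H> \<Longrightarrow> ennreal \<bar>(\<Sum>i<n. h (z i)) - n * (\<integral>z. h z \<partial>\<mu>)\<bar> \<le> V z"
    and int0: "(\<integral>\<^sup>+z. V z \<partial>?P) \<le> ennreal (real (n + n) * \<eta> + n * \<eta> + 2 * N / (\<eta> / (4 * B\<^sup>2)) *
         exp (n * (\<eta> / (4 * B\<^sup>2) * (2 * B))\<^sup>2 / 2 - \<eta> / (4 * B\<^sup>2) * (n * \<eta>)))"
    using prob H meas B(2) l cover that
    by (rule symmetrization[where \<mu> = \<mu> and \<H> = \<H> and B = B and l = "\<eta> / (4 * B\<^sup>2)"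
          and s = "n * \<eta>" and n = n and N = N and \<eta> = "real (n + n) * \<eta>"])
  have "n * (\<eta> / (4 * B\<^sup>2) * (2 * B))\<^sup>2 / 2 - \<eta> / (4 * B\<^sup>2) * (n * \<eta>) = - (\<eta>\<^sup>2 / (8 * B\<^sup>2)) * n"
    using B(1) by (simp add: field_simps power2_eq_square)
  then have "real (n + n) * \<eta> + n * \<eta> + 2 * N / (\<eta> / (4 * B\<^sup>2)) *
         exp (n * (\<eta> / (4 * B\<^sup>2) * (2 * B))\<^sup>2 / 2 - \<eta> / (4 * B\<^sup>2) * (n * \<eta>))
       = n * (3 * \<eta>) + 8 * B\<^sup>2 / \<eta> * (N * exp (- (\<eta>\<^sup>2 / (8 * B\<^sup>2)) * n))"
    by (simp add: algebra_simps)
  \<comment> \<open>The exponential term is weakened by a factor \<open>n \<ge> 1\<close>, so that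
    dividing by \<open>n * \<delta>\<close> leaves \<open>b / \<delta>\<close>.\<close>
  also have "\<dots> \<le> n * (3 * \<eta>) + n * (8 * B\<^sup>2 / \<eta> * (N * exp (- (\<eta>\<^sup>2 / (8 * B\<^sup>2)) * n)))"
  proof -
    have "1 * (8 * B\<^sup>2 / \<eta> * (N * exp (- (\<eta>\<^sup>2 / (8 * B\<^sup>2)) * n)))
        \<le> n * (8 * B\<^sup>2 / \<eta> * (N * exp (- (\<eta>\<^sup>2 / (8 * B\<^sup>2)) * n)))"
      using pos by (intro mult_right_mono) auto
    then show ?thesis by simp
  qed
  also have "\<dots> = n * b" by (simp add: b_def distrib_left)
  finally have int: "(\<integral>\<^sup>+z. V z \<partial>?P) \<le> ennreal (n * b)"
    using int0 by (meson ennreal_leI order_trans)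
  \<comment> \<open>The preimage of this measurable set encloses the deviation event, which is all
    that an upper bound on outer probability requires.\<close>
  define A where "A = {z \<in> space ?P. 1 \<le> ennreal (1 / (n * \<delta>)) * V z}"
  have A[measurable]: "A \<in> sets ?P" unfolding A_def by measurable
  have "emeasure ?P A \<le> ennreal (1 / (n * \<delta>)) * (\<integral>\<^sup>+z. V z * indicator (space ?P) z \<partial>?P)"
    unfolding A_def by (rule nn_integral_Markov_inequality) auto
  also have "(\<integral>\<^sup>+z. V z * indicator (space ?P) z \<partial>?P) = (\<integral>\<^sup>+z. V z \<partial>?P)"
    by (intro nn_integral_cong) auto
  also have "ennreal (1 / (n * \<delta>)) * \<dots> \<le> ennreal (1 / (n * \<delta>)) * ennreal (n * b)"
    using int by (rule mult_left_mono) auto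
  also have "\<dots> = ennreal (b / \<delta>)"
    using pos b by (subst ennreal_mult[symmetric]) (auto simp: field_simps)
  finally have "emeasure M (W -` A \<inter> space M) \<le> ennreal (b / \<delta>)"
    by (subst (asm) W_law[symmetric]) (simp add: emeasure_distr)
  then have "M.prob (W -` A \<inter> space M) \<le> b / \<delta>"
    using b pos by (simp add: M.emeasure_eq_measure)
  moreover have "{\<omega> \<in> space M. \<exists>h\<in>\<H>. \<bar>(\<Sum>i<n. h (Z i \<omega>)) / n - (\<integral>z. h z \<partial>\<mu>)\<bar> > \<delta>} \<subseteq> W -` A \<inter> space M"
  proof safe
    fix \<omega> h assume \<omega>: "\<omega> \<in> space M" and h: "h \<in> \<H>"
      and gt: "\<delta> < \<bar>(\<Sum>i<n. h (Z i \<omega>)) / n - (\<integral>z. h z \<partial>\<mu>)\<bar>"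
    have W\<omega>: "W \<omega> \<in> space ?P" using W \<omega> by (rule measurable_space)
    have "\<bar>(\<Sum>i<n. h (W \<omega> i)) - n * (\<integral>z. h z \<partial>\<mu>)\<bar> = n * \<bar>(\<Sum>i<n. h (Z i \<omega>)) / n - (\<integral>z. h z \<partial>\<mu>)\<bar>"
    proof -
      have "(\<Sum>i<n. h (W \<omega> i)) - n * (\<integral>z. h z \<partial>\<mu>) = n * ((\<Sum>i<n. h (Z i \<omega>)) / n - (\<integral>z. h z \<partial>\<mu>))"
        using pos(1) by (simp add: W_def right_diff_distrib)
      then show ?thesis by (simp add: abs_mult)
    qed
    also have "\<dots> \<ge> n * \<delta>" using gt by (intro mult_left_mono) auto
    finally have "ennreal (n * \<delta>) \<le> V (W \<omega>)"
      using dev[OF W\<omega> h] by (meson ennreal_leI order_trans)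
    then have "ennreal (1 / (n * \<delta>)) * ennreal (n * \<delta>) \<le> ennreal (1 / (n * \<delta>)) * V (W \<omega>)"
      by (rule mult_left_mono) auto
    moreover have "ennreal (1 / (n * \<delta>)) * ennreal (n * \<delta>) = 1"
      using pos by (subst ennreal_mult[symmetric]) auto
    ultimately show "\<omega> \<in> W -` A" using W\<omega> by (simp add: A_def)
  qed
  moreover have "W -` A \<inter> space M \<in> M.events" by measurable
  ultimately show ?thesis unfolding b_def by (meson M.outer_prob_le order_trans)
qed

text \<open>At fixed radius \<open>\<eta>\<close> the cover size competes with
  \<open>exp (- \<kappa> * n)\<close> for a fixed positive \<open>\<kappa>\<close>, so it may grow
  with \<open>n\<close> at any subexponential rate.\<close>

lemma glivenko_cantelli:
  fixes \<mu> :: "'z measure" and \<H> :: "('z \<Rightarrow> real) set" and B :: real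
  assumes M: "prob_space M"
    and indep: "prob_space.indep_vars M (\<lambda>_. \<mu>') Z UNIV"
    and law: "\<And>i. distr M \<mu>' (Z i) = \<mu>"
    and H: "\<H> \<noteq> {}" and meas: "P_measurable_class \<mu> \<H>"
    and B: "B > 0" "\<And>h z. h \<in> \<H> \<Longrightarrow> z \<in> space \<mu> \<Longrightarrow> \<bar>h z\<bar> \<le> B"
    and cover: "\<And>\<eta>. \<eta> > 0 \<Longrightarrow> \<exists>N :: nat \<Rightarrow> nat.
      (\<forall>n. \<forall>z\<in>{..<n} \<rightarrow> space \<mu>. \<exists>S\<subseteq>\<H>. finite S \<and> card S \<le> N n \<and>
        (\<forall>h\<in>\<H>. \<exists>g\<in>S. (\<Sum>i<n. \<bar>h (z i) - g (z i)\<bar>) \<le> real n * \<eta>)) \<and>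
      (\<forall>\<kappa>>0. (\<lambda>n. N n * exp (- \<kappa> * real n)) \<longlonglongrightarrow> 0)"
    and \<delta>: "\<delta> > 0"
  shows "(\<lambda>n. outer_prob M
     {\<omega> \<in> space M. \<exists>h\<in>\<H>. \<bar>(\<Sum>i<n. h (Z i \<omega>)) / n - (\<integral>z. h z \<partial>\<mu>)\<bar> > \<delta>}) \<longlonglongrightarrow> 0"
    (is "?D \<longlonglongrightarrow> 0")
proof (rule LIMSEQ_I)
  interpret M: prob_space M by fact
  fix r :: real assume r: "r > 0"
  \<comment> \<open>Chosen so that \<open>(3 * \<eta> + 3 * \<eta>) / \<delta> = r\<close>; the
    second \<open>3 * \<eta>\<close> absorbs the exponential term.\<close>
  define \<eta> where "\<eta> = r * \<delta> / 6"
  have \<eta>: "\<eta> > 0" using r \<delta> by (simp add: \<eta>_def)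
  obtain N :: "nat \<Rightarrow> nat" where N: "\<And>n z. z \<in> {..<n} \<rightarrow> space \<mu> \<Longrightarrow> \<exists>S\<subseteq>\<H>. finite S \<and> card S \<le> N n \<and>
        (\<forall>h\<in>\<H>. \<exists>g\<in>S. (\<Sum>i<n. \<bar>h (z i) - g (z i)\<bar>) \<le> real n * \<eta>)"
      and lim: "\<And>\<kappa>. \<kappa> > 0 \<Longrightarrow> (\<lambda>n. N n * exp (- \<kappa> * real n)) \<longlonglongrightarrow> 0"
    using cover[OF \<eta>] by blast
  let ?\<kappa> = "\<eta>\<^sup>2 / (8 * B\<^sup>2)"
  \<comment> \<open>The rate is halved because the cover is taken on \<open>n + n\<close> points
    while the exponential is in \<open>n\<close>.\<close>
  have "?\<kappa> / 2 > 0" using \<eta> B by simp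
  from lim[OF this] have "(\<lambda>n. N (n + n) * exp (- (?\<kappa> / 2) * real (n + n))) \<longlonglongrightarrow> 0"
    by (rule filterlim_compose) (rule filterlim_subseq, simp add: strict_mono_def)
  moreover have "N (n + n) * exp (- (?\<kappa> / 2) * real (n + n)) = N (n + n) * exp (- ?\<kappa> * n)" for n
    by (simp add: field_simps)
  ultimately have "(\<lambda>n. N (n + n) * exp (- ?\<kappa> * n)) \<longlonglongrightarrow> 0" by (simp only:)
  from tendsto_mult_right_zero[OF this, of "8 * B\<^sup>2 / \<eta>"]
  have "\<forall>\<^sub>F n in sequentially. 8 * B\<^sup>2 / \<eta> * (N (n + n) * exp (- ?\<kappa> * n)) < 3 * \<eta>"
    by (rule order_tendstoD(2)) (use \<eta> in simp)
  then have "\<forall>\<^sub>F n in sequentially. ?D n < r"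
    using eventually_gt_at_top[of 0]
  proof eventually_elim
    case (elim n)
    have "?D n \<le> (3 * \<eta> + 8 * B\<^sup>2 / \<eta> * (N (n + n) * exp (- ?\<kappa> * n))) / \<delta>"
      using M indep law H meas B elim(2) \<eta> \<delta> N[of _ "n + n"]
      by (rule outer_prob_deviation_le[where \<mu> = \<mu> and \<H> = \<H> and B = B and \<eta> = \<eta> and N = "N (n + n)"])
    also have "\<dots> < (3 * \<eta> + 3 * \<eta>) / \<delta>"
      using elim \<delta> by (intro divide_strict_right_mono add_strict_left_mono) auto
    also have "\<dots> = r" using \<delta> by (simp add: \<eta>_def)
    finally show ?case .
  qed
  moreover have "0 \<le> ?D n" for n by (rule M.outer_prob_nonneg) auto
  ultimately show "\<exists>no. \<forall>n\<ge>no. norm (?D n - 0) < r"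
    by (auto simp: eventually_sequentially)
qed

section \<open>From the entropy integral to empirical covers\<close>

lemma covering_number_antimono:
  assumes "\<delta> \<le> \<delta>'"
  shows "covering_number \<delta>' \<G> Q \<le> covering_number \<delta> \<G> Q"
  unfolding covering_number_def using assms
  by (intro INF_superset_mono) (auto, meson order_less_le_trans)

lemma sqrt_log_mono: "N \<le> N' \<Longrightarrow> sqrt_log N \<le> sqrt_log N'"
proof (cases N; cases N')
  fix k k' assume "N \<le> N'" "N = enat k" "N' = enat k'"
  \<comment> \<open>An empty cover gives \<open>k = 0\<close>, where \<open>ln\<close> has a default
    value; it is treated apart.\<close>
  moreover have "ln (real k) \<le> ln (real k')" if "k \<le> k'"
  proof (cases "k = 0")
    case True
    then show ?thesis by (cases "k' = 0") auto
  qed (use that in auto)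
  ultimately show ?thesis by (auto simp: sqrt_log_def intro!: ennreal_leI)
qed (auto simp: sqrt_log_def)

lemma sqrt_log_le_imp:
  assumes "sqrt_log N \<le> ennreal c" "c \<ge> 0"
  obtains k where "N = enat k" "k \<le> nat \<lceil>exp (c\<^sup>2)\<rceil>"
proof (cases N)
  case (enat k)
  have "real k \<le> exp (c\<^sup>2)"
  proof (cases "k = 0")
    case False
    have "sqrt (ln (real k)) \<le> c" using assms enat by (simp add: sqrt_log_def)
    then have "ln (real k) \<le> c\<^sup>2" by (rule sqrt_le_D)
    then show ?thesis using False by (metis exp_le_cancel_iff exp_ln of_nat_0_less_iff neq0_conv)
  qed simp
  then show thesis using enat that by (metis real_nat_ceiling_ge of_nat_le_iff order_trans)
next
  case infinity
  then show thesis using assms(1) by (simp add: sqrt_log_def top_unique)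
qed

text \<open>The infimum is attained because \<open>enat\<close> is well-ordered and the value
  \<open>enat k\<close> rules out an infimum over the empty set.\<close>

lemma covering_number_eq_enatE:
  assumes "covering_number \<delta> \<G> Q = enat k"
  obtains C where "finite C" "card C = k" "\<And>g. g \<in> \<G> \<Longrightarrow> \<exists>h\<in>C. L2_norm Q (\<lambda>x. g x - h x) < \<delta>"
proof -
  let ?A = "(\<lambda>C. enat (card C)) ` {C. finite C \<and> (\<forall>g\<in>\<G>. \<exists>h\<in>C. L2_norm Q (\<lambda>x. g x - h x) < \<delta>)}"
  have Inf: "Inf ?A = enat k" using assms by (simp add: covering_number_def)
  then have ne: "?A \<noteq> {}" by (metis Inf_enat_def enat.distinct(2))
  then obtain a where "a \<in> ?A" by blast
  then have "(LEAST x. x \<in> ?A) \<in> ?A" by (rule LeastI)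
  then have "enat k \<in> ?A" using ne Inf by (simp only: Inf_enat_def if_False)
  then show thesis using that by auto
qed

text \<open>\<open>map_pmf x (pmf_of_set {..<n})\<close> is the empirical distribution; repeated
  sample points receive their multiplicity as weight.\<close>

lemma L2_norm_empirical:
  fixes n :: nat
  assumes "n > 0"
  shows "L2_norm (map_pmf x (pmf_of_set {..<n})) g = sqrt ((\<Sum>i<n. (g (x i))\<^sup>2) / n)"
  using assms by (simp add: L2_norm_def integral_pmf_of_set lessThan_empty_iff)

text \<open>Cauchy-Schwarz links the L_2 balls of the entropy condition to the L_1 distances used in
  symmetrization.\<close>

lemma sum_abs_le_L2_norm_empirical:
  fixes n :: nat
  assumes "n > 0"
  shows "(\<Sum>i<n. \<bar>g (x i)\<bar>) \<le> n * L2_norm (map_pmf x (pmf_of_set {..<n})) g"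
proof -
  have "(\<Sum>i<n. \<bar>g (x i)\<bar> * 1)\<^sup>2 \<le> (\<Sum>i<n. \<bar>g (x i)\<bar>\<^sup>2) * (\<Sum>i<n. 1\<^sup>2)"
    by (rule Cauchy_Schwarz_ineq_sum)
  also have "\<dots> = n\<^sup>2 * ((\<Sum>i<n. (g (x i))\<^sup>2) / n)" using assms by (simp add: power2_eq_square)
  finally have "(\<Sum>i<n. \<bar>g (x i)\<bar>) \<le> sqrt (n\<^sup>2 * ((\<Sum>i<n. (g (x i))\<^sup>2) / n))"
    by (intro real_le_rsqrt) simp
  also have "\<dots> = n * L2_norm (map_pmf x (pmf_of_set {..<n})) g"
    unfolding L2_norm_empirical[OF assms] real_sqrt_mult by simp
  finally show ?thesis .
qed

text \<open>The integrand is antitone in the radius, so an infinite value at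
  \<open>\<epsilon>\<close> would persist on all of \<open>(0, \<epsilon>)\<close> and make the
  integral infinite.\<close>

lemma BUEI_class_entropy_bounded:
  assumes "BUEI_class S \<G>" "\<epsilon> \<in> {0<..<1}"
  obtains c where "c \<ge> 0" "\<And>Q. finite (set_pmf Q) \<Longrightarrow> set_pmf Q \<subseteq> S \<Longrightarrow> L2_norm Q (envelope \<G>) > 0 \<Longrightarrow>
    sqrt_log (covering_number (\<epsilon> * L2_norm Q (envelope \<G>)) \<G> Q) \<le> ennreal c"
proof -
  let ?\<Q> = "{Q. finite (set_pmf Q) \<and> set_pmf Q \<subseteq> S \<and> L2_norm Q (envelope \<G>) > 0}"
  define \<phi> where "\<phi> \<epsilon> = (SUP Q\<in>?\<Q>. sqrt_log (covering_number (\<epsilon> * L2_norm Q (envelope \<G>)) \<G> Q))" for \<epsilon>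
  have anti: "\<phi> \<epsilon>' \<ge> \<phi> \<epsilon>" if "\<epsilon>' \<le> \<epsilon>" for \<epsilon>'
    unfolding \<phi>_def using that
    by (intro SUP_mono) (auto intro!: bexI sqrt_log_mono covering_number_antimono)
  have "\<phi> \<epsilon> \<noteq> \<infinity>"
  proof
    assume inf: "\<phi> \<epsilon> = \<infinity>"
    have "(\<integral>\<^sup>+e. \<infinity> * indicator {0<..<\<epsilon>} e \<partial>lborel) \<le> (\<integral>\<^sup>+e\<in>{0<..<1}. \<phi> e \<partial>lborel)"
    proof (rule nn_integral_mono)
      fix e :: real
      show "\<infinity> * indicator {0<..<\<epsilon>} e \<le> \<phi> e * indicator {0<..<1} e"
        using anti[of e] inf assms(2) by (auto simp: indicator_def top_unique)
    qed
    moreover have "(\<integral>\<^sup>+e. \<infinity> * indicator {0<..<\<epsilon>} e \<partial>lborel) = \<infinity>"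
      using assms(2) by (subst nn_integral_cmult_indicator) (auto simp: ennreal_top_mult)
    ultimately show False using assms(1) by (simp add: BUEI_class_def \<phi>_def top_unique)
  qed
  then obtain c where c: "c \<ge> 0" "\<phi> \<epsilon> = ennreal c" by (cases "\<phi> \<epsilon>") auto
  show thesis
  proof (rule that[OF c(1)])
    fix Q assume "finite (set_pmf Q)" "set_pmf Q \<subseteq> S" "L2_norm Q (envelope \<G>) > 0"
    then have "sqrt_log (covering_number (\<epsilon> * L2_norm Q (envelope \<G>)) \<G> Q) \<le> \<phi> \<epsilon>"
      unfolding \<phi>_def by (intro SUP_upper) auto
    then show "sqrt_log (covering_number (\<epsilon> * L2_norm Q (envelope \<G>)) \<G> Q) \<le> ennreal c" by (simp add: c)
  qed
qed

text \<open>Empirical distributions of points of \<open>S\<close> are among the finitely supported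
  measures of the supremum, which makes \<open>N\<close> independent of both \<open>n\<close> and
  the sample. The centres need not belong to the class.\<close>

lemma BUEI_class_uniform_cover:
  fixes S :: "'x set"
  assumes BUEI: "BUEI_class S \<G>" and ne: "\<G> \<noteq> {}" and \<eta>: "\<eta> > 0" and B0: "B > 0"
    and B: "\<And>g x. g \<in> \<G> \<Longrightarrow> x \<in> S \<Longrightarrow> \<bar>g x\<bar> \<le> B"
  obtains N :: nat where "\<And>n x. x \<in> {..<n} \<rightarrow> S \<Longrightarrow>
    \<exists>C. finite C \<and> card C \<le> N \<and> (\<forall>g\<in>\<G>. \<exists>h\<in>C. (\<Sum>i<n. \<bar>g (x i) - h (x i)\<bar>) \<le> real n * \<eta>)"
proof -
  \<comment> \<open>1/2 keeps the radius inside the range of the entropy integral;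
    \<open>\<eta> / B\<close> makes the radius relative to the envelope, itself at most
    \<open>B\<close>, no larger than \<open>\<eta>\<close>.\<close>
  define \<epsilon> where "\<epsilon> = min (1 / 2) (\<eta> / B)"
  have \<epsilon>: "\<epsilon> \<in> {0<..<1}" "\<epsilon> * B \<le> \<eta>" using \<eta> B0 by (auto simp: \<epsilon>_def min_def field_simps)
  obtain c where c: "c \<ge> 0" "\<And>Q. finite (set_pmf Q) \<Longrightarrow> set_pmf Q \<subseteq> S \<Longrightarrow> L2_norm Q (envelope \<G>) > 0 \<Longrightarrow>
      sqrt_log (covering_number (\<epsilon> * L2_norm Q (envelope \<G>)) \<G> Q) \<le> ennreal c"
    using BUEI_class_entropy_bounded[OF BUEI \<epsilon>(1)] by blast
  have env: "\<bar>g x\<bar> \<le> envelope \<G> x" "envelope \<G> x \<le> B" if "x \<in> S" "g \<in> \<G>" for x g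
  proof -
    show "\<bar>g x\<bar> \<le> envelope \<G> x"
      unfolding envelope_def using that B by (intro cSUP_upper bdd_aboveI2[of _ _ B]) auto
    show "envelope \<G> x \<le> B"
      unfolding envelope_def using that B by (intro cSUP_least) auto
  qed
  show thesis
  proof (rule that)
    fix n and x :: "nat \<Rightarrow> 'x" assume x: "x \<in> {..<n} \<rightarrow> S"
    let ?Q = "map_pmf x (pmf_of_set {..<n})" and ?F = "envelope \<G>"
    \<comment> \<open>The \<open>+ 1\<close> makes room for the singleton cover of the degenerate
      case.\<close>
    show "\<exists>C. finite C \<and> card C \<le> nat \<lceil>exp (c\<^sup>2)\<rceil> + 1 \<and>
      (\<forall>g\<in>\<G>. \<exists>h\<in>C. (\<Sum>i<n. \<bar>g (x i) - h (x i)\<bar>) \<le> real n * \<eta>)"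
    proof (cases "n > 0 \<and> L2_norm ?Q ?F > 0")
      case True
      then have n: "n > 0" by simp
      have Q: "finite (set_pmf ?Q)" "set_pmf ?Q \<subseteq> S" using n x by (auto simp: set_pmf_of_set lessThan_empty_iff)
      obtain k where k: "covering_number (\<epsilon> * L2_norm ?Q ?F) \<G> ?Q = enat k" "k \<le> nat \<lceil>exp (c\<^sup>2)\<rceil>"
        using sqrt_log_le_imp[OF c(2)[OF Q] c(1)] True by blast
      obtain C where C: "finite C" "card C = k"
        "\<And>g. g \<in> \<G> \<Longrightarrow> \<exists>h\<in>C. L2_norm ?Q (\<lambda>x. g x - h x) < \<epsilon> * L2_norm ?Q ?F"
        using covering_number_eq_enatE[OF k(1)] by blast
      obtain g0 where g0: "g0 \<in> \<G>" using ne by auto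
      have "L2_norm ?Q ?F \<le> B"
      proof -
        have "(\<Sum>i<n. (?F (x i))\<^sup>2) \<le> (\<Sum>i<n. B\<^sup>2)"
        proof (rule sum_mono)
          fix i assume "i \<in> {..<n}"
          then have "x i \<in> S" using x by auto
          from env[OF this g0] show "(?F (x i))\<^sup>2 \<le> B\<^sup>2" by (intro power_mono) auto
        qed
        then have "sqrt ((\<Sum>i<n. (?F (x i))\<^sup>2) / n) \<le> sqrt (B\<^sup>2)"
          using n by (intro real_sqrt_le_mono) (simp add: field_simps)
        then show ?thesis using n B0 by (simp only: L2_norm_empirical real_sqrt_abs abs_of_pos)
      qed
      then have le: "\<epsilon> * L2_norm ?Q ?F \<le> \<eta>" using \<epsilon> by (intro order_trans[OF mult_left_mono \<epsilon>(2)]) auto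
      have "\<exists>h\<in>C. (\<Sum>i<n. \<bar>g (x i) - h (x i)\<bar>) \<le> real n * \<eta>" if g: "g \<in> \<G>" for g
      proof -
        obtain h where h: "h \<in> C" "L2_norm ?Q (\<lambda>x. g x - h x) < \<epsilon> * L2_norm ?Q ?F" using C(3)[OF g] by blast
        have "(\<Sum>i<n. \<bar>g (x i) - h (x i)\<bar>) \<le> n * L2_norm ?Q (\<lambda>x. g x - h x)"
          using sum_abs_le_L2_norm_empirical[OF n, of "\<lambda>x. g x - h x" x] by simp
        also have "\<dots> \<le> real n * \<eta>" using h(2) le by (intro mult_left_mono) auto
        finally show ?thesis using h(1) by blast
      qed
      then show ?thesis using C(1,2) k(2) by (intro exI[of _ C]) auto
    next
      \<comment> \<open>The entropy condition is silent when the envelope has norm zero. Then every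
        function vanishes on the sample (or the sample is empty), and the zero function
        covers.\<close>
      case False
      have "g (x i) = 0" if "g \<in> \<G>" "i < n" for g i
      proof -
        have n: "n > 0" using that by simp
        have xi: "x i \<in> S" using x that by auto
        have "sqrt ((\<Sum>i<n. (?F (x i))\<^sup>2) / n) \<le> 0"
          using False n by (simp add: L2_norm_empirical not_less)
        then have "(\<Sum>i<n. (?F (x i))\<^sup>2) \<le> 0" using n by (simp add: divide_le_0_iff)
        then have "(\<Sum>i<n. (?F (x i))\<^sup>2) = 0" by (intro antisym sum_nonneg) auto
        then have "?F (x i) = 0" using that by (simp add: sum_nonneg_eq_0_iff)
        then show ?thesis using env(1)[OF xi that(1)] by simp
      qed
      then have "(\<Sum>i<n. \<bar>g (x i) - 0\<bar>) \<le> real n * \<eta>" if "g \<in> \<G>" for g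
        using that \<eta> by (subst sum.neutral) auto
      then show ?thesis by (intro exI[of _ "{\<lambda>_. 0}"]) simp
    qed
  qed
qed

section \<open>The Horvitz--Thompson objective\<close>

text \<open>The degree \<open>d\<close> is symbolic, so the exponential is split into
  \<open>d\<close> equal factors, each dominating one linear factor. The shape of the polynomial is
  that of the cover size in \<open>HT_class_cover\<close>.\<close>

lemma polynomial_times_exp_tendsto_0:
  assumes "\<kappa> > 0"
  shows "(\<lambda>n. real (a * (b * (n * m + 1) ^ d)) * exp (- \<kappa> * real n)) \<longlonglongrightarrow> 0"
proof -
  have "(\<lambda>n. (real m * n + 1) ^ d * exp (- \<kappa> * real n)) \<longlonglongrightarrow> 0"
  proof (cases "d = 0")
    case True
    then show ?thesis using assms by (simp, real_asymp)
  next
    case False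
    define \<kappa>' where "\<kappa>' = \<kappa> / d"
    have \<kappa>': "\<kappa>' > 0" using assms False by (simp add: \<kappa>'_def)
    then have "(\<lambda>n. (real m * real n + 1) * exp (- \<kappa>' * real n)) \<longlonglongrightarrow> 0"
      by real_asymp
    then have "(\<lambda>n. ((real m * n + 1) * exp (- \<kappa>' * real n)) ^ d) \<longlonglongrightarrow> 0 ^ d" by (rule tendsto_power)
    moreover have "exp (- \<kappa>' * real n) ^ d = exp (- \<kappa> * real n)" for n
      unfolding exp_of_nat_mult[symmetric] using False by (simp add: \<kappa>'_def)
    ultimately show ?thesis using False by (simp add: power_mult_distrib power_0_left)
  qed
  from tendsto_mult_right_zero[OF this, of "real (a * b)"] show ?thesis
    by (simp add: mult_ac add_ac)
qed

section \<open>The joint law of point and priority, and covers of the weighted class\<close>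

context
  fixes M :: "'w measure" and P :: "'x measure" and K :: "'x \<Rightarrow> real measure"
    and X :: "nat \<Rightarrow> 'w \<Rightarrow> 'x" and R :: "nat \<Rightarrow> 'w \<Rightarrow> real"
  assumes sample: "iid_priority_sample M P K X R"
begin

abbreviation (input) joint_law :: "('x \<times> real) measure" where
  "joint_law \<equiv> distr M (P \<Otimes>\<^sub>M borel) (\<lambda>\<omega>. (X 0 \<omega>, R 0 \<omega>))"

lemma sample_prob_space: "prob_space M"
  and sample_indep: "prob_space.indep_vars M (\<lambda>_. P \<Otimes>\<^sub>M borel) (\<lambda>i \<omega>. (X i \<omega>, R i \<omega>)) UNIV"
  and sample_kernel: "K \<in> P \<rightarrow>\<^sub>M prob_algebra borel"
  and sample_marginal: "distr M P (X i) = P"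
  and sample_rectangle: "A \<in> sets P \<Longrightarrow> B \<in> sets borel \<Longrightarrow>
    emeasure M {\<omega> \<in> space M. X i \<omega> \<in> A \<and> R i \<omega> \<in> B} = (\<integral>\<^sup>+x\<in>A. emeasure (K x) B \<partial>P)"
  using sample by (auto simp: iid_priority_sample_def)

interpretation M: prob_space M by (rule sample_prob_space)

lemma sample_measurable[measurable]: "(\<lambda>\<omega>. (X i \<omega>, R i \<omega>)) \<in> M \<rightarrow>\<^sub>M P \<Otimes>\<^sub>M borel"
  using sample_indep by (auto simp: M.indep_vars_def)

lemma sample_point_measurable: "X i \<in> M \<rightarrow>\<^sub>M P"
  using measurable_compose[OF sample_measurable measurable_fst] by simp

lemma prob_space_P: "prob_space P"
  using M.prob_space_distr[OF sample_point_measurable[of 0]] by (simp add: sample_marginal)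

lemma kernel_prob_space: "x \<in> space P \<Longrightarrow> prob_space (K x)"
  and kernel_sets: "x \<in> space P \<Longrightarrow> sets (K x) = sets borel"
  using measurable_space[OF sample_kernel] by (auto simp: space_prob_algebra)

lemma kernel_subprob[measurable]: "K \<in> P \<rightarrow>\<^sub>M subprob_algebra borel"
  using sample_kernel by (rule measurable_prob_algebraD)

text \<open>The semidirect product of \<open>P\<close> with the kernel \<open>K\<close>, written as
  a bind so that integrals iterate: over the priority given the point, then over the point.\<close>

definition kernel_law :: "('x \<times> real) measure" where
  "kernel_law = P \<bind> (\<lambda>x. distr (K x) (P \<Otimes>\<^sub>M borel) (Pair x))"

lemma kernel_pair_measurable[measurable]:
  "(\<lambda>x. distr (K x) (P \<Otimes>\<^sub>M borel) (Pair x)) \<in> P \<rightarrow>\<^sub>M subprob_algebra (P \<Otimes>\<^sub>M borel)"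
  by (rule measurable_distr2[where M = borel]) measurable

text \<open>The sampling assumption fixes the law on rectangles only; these are intersection-stable
  and generate the product sigma-algebra. As the right-hand side is free of \<open>i\<close>, the
  pairs are identically distributed.\<close>

lemma distr_sample_eq_kernel_law: "distr M (P \<Otimes>\<^sub>M borel) (\<lambda>\<omega>. (X i \<omega>, R i \<omega>)) = kernel_law"
proof (rule measure_eqI_generator_eq[where E = "{A \<times> B | A B. A \<in> sets P \<and> B \<in> sets borel}"
      and A = "\<lambda>_. space P \<times> UNIV" and \<Omega> = "space P \<times> UNIV"])
  have ne: "space P \<noteq> {}" by (rule prob_space.not_empty[OF prob_space_P])
  show "Int_stable {A \<times> B | A B. A \<in> sets P \<and> B \<in> sets (borel :: real measure)}"
    using Int_stable_pair_measure_generator[of P "borel :: real measure"] by simp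
  show "{A \<times> B | A B. A \<in> sets P \<and> B \<in> sets borel} \<subseteq> Pow (space P \<times> (UNIV :: real set))"
    using sets.space_closed[of P] by auto
  show "sets (distr M (P \<Otimes>\<^sub>M borel) (\<lambda>\<omega>. (X i \<omega>, R i \<omega>))) =
      sigma_sets (space P \<times> UNIV) {A \<times> B | A B. A \<in> sets P \<and> B \<in> sets borel}"
    by (simp add: sets_pair_measure)
  show "sets kernel_law = sigma_sets (space P \<times> UNIV) {A \<times> B | A B. A \<in> sets P \<and> B \<in> sets borel}"
  proof -
    have "sets kernel_law = sets (P \<Otimes>\<^sub>M (borel :: real measure))"
      unfolding kernel_law_def by (rule sets_bind) (simp_all add: ne)
    then show ?thesis by (simp add: sets_pair_measure)
  qed
  show "range (\<lambda>_. space P \<times> (UNIV :: real set)) \<subseteq> {A \<times> B | A B. A \<in> sets P \<and> B \<in> sets borel}"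
  proof -
    have "\<exists>A B. space P \<times> (UNIV :: real set) = A \<times> B \<and> A \<in> sets P \<and> B \<in> sets borel"
      by (rule exI[of _ "space P"], rule exI[of _ UNIV]) simp
    then show ?thesis by (simp add: image_subset_iff)
  qed
  show "emeasure (distr M (P \<Otimes>\<^sub>M borel) (\<lambda>\<omega>. (X i \<omega>, R i \<omega>))) (space P \<times> UNIV) \<noteq> \<infinity>" for j :: nat
    using finite_measure.emeasure_finite[OF M.finite_measure_distr[OF sample_measurable]] by simp
  fix A' assume "A' \<in> {A \<times> B | A B. A \<in> sets P \<and> B \<in> sets (borel :: real measure)}"
  then obtain A B where A': "A' = A \<times> B" and [measurable]: "A \<in> sets P" "B \<in> sets borel" by auto
  have "emeasure (distr M (P \<Otimes>\<^sub>M borel) (\<lambda>\<omega>. (X i \<omega>, R i \<omega>))) A' =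
      emeasure M {\<omega> \<in> space M. X i \<omega> \<in> A \<and> R i \<omega> \<in> B}"
    unfolding A' by (subst emeasure_distr) (auto intro!: arg_cong[where f = "emeasure M"])
  also have "\<dots> = (\<integral>\<^sup>+x\<in>A. emeasure (K x) B \<partial>P)" by (rule sample_rectangle) measurable
  also have "\<dots> = (\<integral>\<^sup>+x. emeasure (distr (K x) (P \<Otimes>\<^sub>M borel) (Pair x)) A' \<partial>P)"
  proof (rule nn_integral_cong)
    fix x assume x: "x \<in> space P"
    have [measurable_cong]: "sets (K x) = sets borel" by (rule kernel_sets[OF x])
    have "Pair x \<in> K x \<rightarrow>\<^sub>M P \<Otimes>\<^sub>M borel"
      unfolding measurable_cong_sets[OF kernel_sets[OF x] refl] using x by measurable
    moreover have "Pair x -` (A \<times> B) \<inter> space (K x) = (if x \<in> A then B else {})"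
      using sets_eq_imp_space_eq[OF kernel_sets[OF x]] by auto
    ultimately show "emeasure (K x) B * indicator A x = emeasure (distr (K x) (P \<Otimes>\<^sub>M borel) (Pair x)) A'"
      unfolding A' by (subst emeasure_distr) auto
  qed
  also have "\<dots> = emeasure kernel_law A'"
    unfolding kernel_law_def A' by (rule emeasure_bind[symmetric, OF ne kernel_pair_measurable]) measurable
  finally show "emeasure (distr M (P \<Otimes>\<^sub>M borel) (\<lambda>\<omega>. (X i \<omega>, R i \<omega>))) A' = emeasure kernel_law A'" .
qed auto

lemma cond_cdf_le_1: "x \<in> space P \<Longrightarrow> cond_cdf K r x \<le> 1"
  unfolding cond_cdf_def by (intro prob_space.prob_le_1 kernel_prob_space)

lemma cond_cdf_nonneg: "0 \<le> cond_cdf K r x"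
  by (simp add: cond_cdf_def)

lemma cond_cdf_mono:
  assumes "x \<in> space P" "r \<le> s"
  shows "cond_cdf K r x \<le> cond_cdf K s x"
  unfolding cond_cdf_def
  using assms finite_measure.finite_measure_mono[of "K x" "{..<r}" "{..<s}"] kernel_sets
    prob_space.finite_measure[OF kernel_prob_space] by auto

text \<open>Unbiasedness: the inner integral over the priority is \<open>g x / F * F\<close>, with
  \<open>F\<close> the inclusion probability, and positivity of \<open>F\<close> permits cancelling.
  Measurability is asked of the weighted function as a whole, the form in which the measurability of
  the class supplies it.\<close>

lemma integral_HT_weighted:
  fixes g t :: "'x \<Rightarrow> real"
  assumes meas: "(\<lambda>(x, r). g x * HT_weight K t x r) \<in> borel_measurable joint_law"
    and bound: "\<And>x r. x \<in> space P \<Longrightarrow> \<bar>g x * HT_weight K t x r\<bar> \<le> B"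
    and pos: "\<And>x. x \<in> space P \<Longrightarrow> cond_cdf K (t x) x > 0"
  shows "(\<integral>z. (case z of (x, r) \<Rightarrow> g x * HT_weight K t x r) \<partial>joint_law) = (\<integral>x. g x \<partial>P)"
proof -
  let ?h = "\<lambda>(x, r). g x * HT_weight K t x r"
  have h[measurable]: "?h \<in> borel_measurable (P \<Otimes>\<^sub>M borel)" using meas by simp
  have "(\<integral>z. ?h z \<partial>joint_law) = (\<integral>x. (\<integral>z. ?h z \<partial>distr (K x) (P \<Otimes>\<^sub>M borel) (Pair x)) \<partial>P)"
    unfolding distr_sample_eq_kernel_law kernel_law_def
  proof (rule integral_bind[OF h _ kernel_pair_measurable, where B' = 1])
    show "\<bar>?h z\<bar> \<le> B" if "z \<in> space (P \<Otimes>\<^sub>M borel)" for z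
      using that bound by (auto simp: space_pair_measure)
    show "finite_measure P" by (rule prob_space.finite_measure[OF prob_space_P])
    show "AE x in P. emeasure (distr (K x) (P \<Otimes>\<^sub>M borel) (Pair x))
        (space (distr (K x) (P \<Otimes>\<^sub>M borel) (Pair x))) \<le> ennreal 1"
    proof (rule AE_I2)
      fix x assume x: "x \<in> space P"
      have [measurable_cong]: "sets (K x) = sets borel" by (rule kernel_sets[OF x])
      have "prob_space (distr (K x) (P \<Otimes>\<^sub>M borel) (Pair x))"
        using x by (intro prob_space.prob_space_distr kernel_prob_space) measurable
      then show "emeasure (distr (K x) (P \<Otimes>\<^sub>M borel) (Pair x))
          (space (distr (K x) (P \<Otimes>\<^sub>M borel) (Pair x))) \<le> ennreal 1"
        by (simp only: prob_space.emeasure_space_1 ennreal_1)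
    qed
  qed
  also have "\<dots> = (\<integral>x. g x \<partial>P)"
  proof (rule Bochner_Integration.integral_cong[OF refl])
    fix x assume x: "x \<in> space P"
    interpret Kx: prob_space "K x" by (rule kernel_prob_space[OF x])
    have [measurable_cong]: "sets (K x) = sets borel" by (rule kernel_sets[OF x])
    have "(\<integral>z. ?h z \<partial>distr (K x) (P \<Otimes>\<^sub>M borel) (Pair x)) = (\<integral>r. g x * HT_weight K t x r \<partial>K x)"
      using x by (subst integral_distr[OF _ h]) auto
    also have "\<dots> = (\<integral>r. g x / cond_cdf K (t x) x * indicator {..<t x} r \<partial>K x)"
      by (intro Bochner_Integration.integral_cong) (auto simp: HT_weight_def indicator_def)
    also have "\<dots> = g x / cond_cdf K (t x) x * cond_cdf K (t x) x"
      using sets_eq_imp_space_eq[OF kernel_sets[OF x]] by (simp add: cond_cdf_def)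
    also have "\<dots> = g x" using pos[OF x] by simp
    finally show "(\<integral>z. ?h z \<partial>distr (K x) (P \<Otimes>\<^sub>M borel) (Pair x)) = g x" .
  qed
  finally show ?thesis .
qed

text \<open>With equal indicators the difference is
  \<open>a / p - b / q = (a - b) / p + b * (q - p) / (p * q)\<close>, and both inclusion
  probabilities exceed \<open>\<epsilon>\<close>. Unequal indicators would leave a jump that does
  not shrink with \<open>\<rho>\<close>.\<close>

lemma abs_HT_weight_diff_le:
  assumes "\<epsilon> > 0" "x \<in> space P" "cond_cdf K (t x) x > \<epsilon>" "cond_cdf K (t' x) x > \<epsilon>"
    and "\<bar>b\<bar> \<le> B" "r < t x \<longleftrightarrow> r < t' x" "\<bar>cond_cdf K (t x) x - cond_cdf K (t' x) x\<bar> \<le> \<rho>"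
  shows "\<bar>a * HT_weight K t x r - b * HT_weight K t' x r\<bar> \<le> \<bar>a - b\<bar> / \<epsilon> + B * \<rho> / \<epsilon>\<^sup>2"
proof (cases "r < t x")
  case True
  define p q where "p = cond_cdf K (t x) x" and "q = cond_cdf K (t' x) x"
  have pq: "p > \<epsilon>" "q > \<epsilon>" "\<bar>p - q\<bar> \<le> \<rho>" "p > 0" "q > 0" using assms by (auto simp: p_def q_def)
  have "a * HT_weight K t x r - b * HT_weight K t' x r = a / p - b / q"
    using True assms(6) by (simp add: HT_weight_def p_def q_def)
  also have "\<dots> = (a - b) / p + b * (q - p) / (p * q)" using pq by (simp add: field_simps)
  also have "\<bar>\<dots>\<bar> \<le> \<bar>a - b\<bar> / p + \<bar>b\<bar> * \<bar>p - q\<bar> / (p * q)"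
    using pq by (intro abs_triangle_ineq[THEN order_trans]) (simp add: abs_mult abs_minus_commute)
  also have "\<dots> \<le> \<bar>a - b\<bar> / \<epsilon> + B * \<rho> / \<epsilon>\<^sup>2"
    unfolding power2_eq_square using assms(1,5) pq
    by (intro add_mono frac_le mult_mono) auto
  finally show ?thesis .
next
  case False
  have "0 \<le> \<bar>a - b\<bar> / \<epsilon> + B * \<rho> / \<epsilon>\<^sup>2"
    using assms by (intro add_nonneg_nonneg divide_nonneg_nonneg mult_nonneg_nonneg) auto
  then show ?thesis using False assms(6) by (simp add: HT_weight_def)
qed

text \<open>Pairs of a parameter and a threshold are grouped by the centre near
  \<open>f \<theta>\<close> and by the pattern of the threshold on the sample. The cover must
  consist of members of \<open>\<H>\<close>, which the centres do not provide, so each nonempty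
  group contributes one of its own members.\<close>

lemma HT_class_cover:
  fixes f :: "'p \<Rightarrow> 'x \<Rightarrow> real" and \<Theta> :: "'p set" and \<T> :: "('x \<Rightarrow> real) set"
  defines "\<H> \<equiv> {\<lambda>(x, r). f \<theta> x * HT_weight K t x r | \<theta> t. \<theta> \<in> \<Theta> \<and> t \<in> \<T>}"
  assumes ne: "\<Theta> \<noteq> {}"
    and BUEI: "BUEI_class (space P) (f ` \<Theta>)" and VC: "VC_dim_fun (space P) \<T> < \<infinity>"
    and \<epsilon>: "\<epsilon> > 0" and cdf: "\<And>t x. t \<in> \<T> \<Longrightarrow> x \<in> space P \<Longrightarrow> cond_cdf K (t x) x > \<epsilon>"
    and B: "B > 0" "\<And>\<theta> x. \<theta> \<in> \<Theta> \<Longrightarrow> x \<in> space P \<Longrightarrow> \<bar>f \<theta> x\<bar> \<le> B"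
    and \<eta>: "\<eta> > 0"
  shows "\<exists>N :: nat \<Rightarrow> nat.
    (\<forall>n. \<forall>z\<in>{..<n} \<rightarrow> space joint_law. \<exists>S\<subseteq>\<H>. finite S \<and> card S \<le> N n \<and>
      (\<forall>h\<in>\<H>. \<exists>g\<in>S. (\<Sum>i<n. \<bar>h (z i) - g (z i)\<bar>) \<le> real n * \<eta>)) \<and>
    (\<forall>\<kappa>>0. (\<lambda>n. N n * exp (- \<kappa> * real n)) \<longlonglongrightarrow> 0)"
proof -
  \<comment> \<open>The grid is fine enough that discretizing the inclusion probability costs at
    most \<open>\<eta> / 2\<close> in \<open>abs_HT_weight_diff_le\<close>.\<close>
  define m where "m = nat \<lceil>2 * B / (\<epsilon>\<^sup>2 * \<eta>)\<rceil>"
  have m_ge: "2 * B / (\<epsilon>\<^sup>2 * \<eta>) \<le> m" unfolding m_def by (rule real_nat_ceiling_ge)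
  moreover have "2 * B / (\<epsilon>\<^sup>2 * \<eta>) > 0" using B \<epsilon> \<eta> by simp
  ultimately have m: "m > 0" by (metis le_less_trans not_gr_zero of_nat_0 order_less_irrefl less_le_trans)
  have m_le: "B * (1 / m) / \<epsilon>\<^sup>2 \<le> \<eta> / 2"
    using m_ge m \<epsilon> \<eta> by (simp add: field_simps)
  \<comment> \<open>Two parameters sharing a centre are within twice this radius, that is
    \<open>\<eta> * \<epsilon> / 2\<close>; dividing by \<open>\<epsilon>\<close> leaves the other
    \<open>\<eta> / 2\<close>.\<close>
  have \<eta>': "\<eta> * \<epsilon> / 4 > 0" using \<eta> \<epsilon> by simp
  obtain N where N: "\<And>n x. x \<in> {..<n} \<rightarrow> space P \<Longrightarrow>
    \<exists>C. finite C \<and> card C \<le> N \<and> (\<forall>g\<in>f ` \<Theta>. \<exists>h\<in>C. (\<Sum>i<n. \<bar>g (x i) - h (x i)\<bar>) \<le> real n * (\<eta> * \<epsilon> / 4))"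
    using BUEI_class_uniform_cover[OF BUEI _ \<eta>' B(1), of thesis] ne B(2) by blast
  obtain d where d: "\<And>A. finite A \<Longrightarrow> shatters (subgraph (space P) ` \<T>) A \<Longrightarrow> card A \<le> d"
    using VC_dim_fun_finiteE[OF VC] by blast
  have "\<exists>S\<subseteq>\<H>. finite S \<and> card S \<le> N * ((d + 1) * (n * (m + 2) + 1) ^ d) \<and>
      (\<forall>h\<in>\<H>. \<exists>g\<in>S. (\<Sum>i<n. \<bar>h (z i) - g (z i)\<bar>) \<le> real n * \<eta>)"
    if z: "z \<in> {..<n} \<rightarrow> space joint_law" for n z
  proof -
    define x r where "x i = fst (z i)" and "r i = snd (z i)" for i
    have x: "x i \<in> space P" if "i < n" for i
      using z that by (auto simp: x_def space_pair_measure Pi_iff mem_Times_iff)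
    \<comment> \<open>Index \<open>(i, 0)\<close> records whether point \<open>i\<close> is sampled, index \<open>(i, j + 1)\<close> whether its sampling
      probability exceeds \<open>j / m\<close>. Both are monotone in the threshold.\<close>
    define I where "I = {..<n} \<times> {..<m + 2}"
    define \<phi> where "\<phi> k s = (case k of (i, 0) \<Rightarrow> r i < s | (i, Suc j) \<Rightarrow> j / m < cond_cdf K s (x i))" for k s
    define p where "p t = {k \<in> I. \<phi> k (t (x (fst k)))}" for t
    \<comment> \<open>Per point there is one test for sampling and one for each of the
      \<open>m + 1\<close> levels from 0 to \<open>m\<close>, hence \<open>m + 2\<close>.\<close>
    have I: "finite I" "card I = n * (m + 2)" by (simp_all add: I_def card_cartesian_product)
    have "card (p ` \<T>) \<le> (d + 1) * (card I + 1) ^ d"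
      unfolding p_def
    proof (rule card_monotone_patterns_le[OF I(1), where S = "space P"])
      show "x (fst k) \<in> space P" if "k \<in> I" for k using that x by (auto simp: I_def)
      show "\<phi> k s'" if "k \<in> I" "\<phi> k s" "s \<le> s'" for k s s'
        using that cond_cdf_mono[OF x, of "fst k" s s']
        by (auto simp: I_def \<phi>_def split: nat.splits)
    qed (rule d)
    then have card_p: "card (p ` \<T>) \<le> (d + 1) * (n * (m + 2) + 1) ^ d" by (simp only: I)
    have fin_p: "finite (p ` \<T>)"
      by (rule finite_subset[of _ "Pow I"]) (use I in \<open>auto simp: p_def\<close>)
    obtain C where C: "finite C" "card C \<le> N"
      and near: "\<And>\<theta>. \<theta> \<in> \<Theta> \<Longrightarrow> \<exists>h\<in>C. (\<Sum>i<n. \<bar>f \<theta> (x i) - h (x i)\<bar>) \<le> real n * (\<eta> * \<epsilon> / 4)"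
      using N[of x n] x by (auto simp: Pi_iff)
    obtain a where a: "\<And>\<theta>. \<theta> \<in> \<Theta> \<Longrightarrow> a \<theta> \<in> C"
      "\<And>\<theta>. \<theta> \<in> \<Theta> \<Longrightarrow> (\<Sum>i<n. \<bar>f \<theta> (x i) - a \<theta> (x i)\<bar>) \<le> real n * (\<eta> * \<epsilon> / 4)"
      using near by metis
    define key where "key = (\<lambda>(\<theta>, t). (a \<theta>, p t))"
    \<comment> \<open>One pair per key that actually occurs; on other keys \<open>inv_into\<close>
      is arbitrary and is never evaluated.\<close>
    define rep where "rep = inv_into (\<Theta> \<times> \<T>) key"
    define H where "H = (\<lambda>(\<theta>, t) (x, r). f \<theta> x * HT_weight K t x r)"
    have \<H>_eq: "\<H> = H ` (\<Theta> \<times> \<T>)" by (auto simp: \<H>_def H_def)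
    let ?K = "key ` (\<Theta> \<times> \<T>)"
    have K_sub: "?K \<subseteq> C \<times> p ` \<T>" using a by (auto simp: key_def)
    have fin_Cp: "finite (C \<times> p ` \<T>)" using C fin_p by simp
    have rep: "rep k \<in> \<Theta> \<times> \<T>" "key (rep k) = k" if "k \<in> ?K" for k
      using that by (auto simp: rep_def inv_into_into f_inv_into_f)
    define S where "S = (\<lambda>k. H (rep k)) ` ?K"
    show ?thesis
    proof (intro exI[of _ S] conjI ballI)
      show "S \<subseteq> \<H>" unfolding S_def \<H>_eq using rep(1) by blast
      have fin_K: "finite ?K" by (rule finite_subset[OF K_sub fin_Cp])
      then show "finite S" by (simp add: S_def)
      have "card S \<le> card ?K" unfolding S_def by (rule card_image_le[OF fin_K])
      also have "\<dots> \<le> card (C \<times> p ` \<T>)" by (rule card_mono[OF fin_Cp K_sub])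
      also have "\<dots> \<le> N * ((d + 1) * (n * (m + 2) + 1) ^ d)"
        unfolding card_cartesian_product by (intro mult_le_mono C card_p)
      finally show "card S \<le> N * ((d + 1) * (n * (m + 2) + 1) ^ d)" .
      fix h assume "h \<in> \<H>"
      then obtain \<theta> t where \<theta>: "\<theta> \<in> \<Theta>" and t: "t \<in> \<T>" and h: "h = H (\<theta>, t)" unfolding \<H>_eq by auto
      obtain \<theta>' t' where rep_eq: "rep (key (\<theta>, t)) = (\<theta>', t')" by fastforce
      have mem: "key (\<theta>, t) \<in> ?K" using \<theta> t by auto
      have "(\<theta>', t') \<in> \<Theta> \<times> \<T>" "key (\<theta>', t') = key (\<theta>, t)"
        using rep[OF mem] unfolding rep_eq .
      then have \<theta>': "\<theta>' \<in> \<Theta>" and t': "t' \<in> \<T>" and same: "a \<theta>' = a \<theta>" "p t' = p t"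
        by (auto simp: key_def)
      have pat: "\<phi> k (t (x (fst k))) \<longleftrightarrow> \<phi> k (t' (x (fst k)))" if "k \<in> I" for k
        using same(2) that unfolding p_def by blast
      have ptw: "\<bar>H (\<theta>, t) (z i) - H (\<theta>', t') (z i)\<bar> \<le> \<bar>f \<theta> (x i) - f \<theta>' (x i)\<bar> / \<epsilon> + \<eta> / 2"
        if i: "i < n" for i
      proof -
        have "\<bar>f \<theta> (x i) * HT_weight K t (x i) (r i) - f \<theta>' (x i) * HT_weight K t' (x i) (r i)\<bar>
            \<le> \<bar>f \<theta> (x i) - f \<theta>' (x i)\<bar> / \<epsilon> + B * (1 / m) / \<epsilon>\<^sup>2"
        proof (rule abs_HT_weight_diff_le[OF \<epsilon> x[OF i]])
          show "r i < t (x i) \<longleftrightarrow> r i < t' (x i)"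
            using pat[of "(i, 0)"] i by (simp add: I_def \<phi>_def)
          show "\<bar>cond_cdf K (t (x i)) (x i) - cond_cdf K (t' (x i)) (x i)\<bar> \<le> 1 / m"
          proof (rule abs_diff_le_if_same_levels[OF m])
            show "j / m < cond_cdf K (t (x i)) (x i) \<longleftrightarrow> j / m < cond_cdf K (t' (x i)) (x i)"
              if "j \<le> m" for j
              using pat[of "(i, Suc j)"] i that by (simp add: I_def \<phi>_def)
          qed (simp_all add: cond_cdf_le_1 cond_cdf_nonneg x[OF i])
        qed (use B(2) cdf \<theta>' t t' x[OF i] in auto)
        with m_le have "\<bar>f \<theta> (x i) * HT_weight K t (x i) (r i) - f \<theta>' (x i) * HT_weight K t' (x i) (r i)\<bar>
            \<le> \<bar>f \<theta> (x i) - f \<theta>' (x i)\<bar> / \<epsilon> + \<eta> / 2" by linarith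
        then show ?thesis by (simp add: H_def x_def r_def case_prod_unfold)
      qed
      have "(\<Sum>i<n. \<bar>f \<theta> (x i) - f \<theta>' (x i)\<bar>)
          \<le> (\<Sum>i<n. \<bar>f \<theta> (x i) - a \<theta> (x i)\<bar> + \<bar>f \<theta>' (x i) - a \<theta>' (x i)\<bar>)"
        by (rule sum_mono) (simp add: same)
      also have "\<dots> \<le> real n * (\<eta> * \<epsilon> / 4) + real n * (\<eta> * \<epsilon> / 4)"
        unfolding sum.distrib by (intro add_mono a(2) \<theta> \<theta>')
      finally have f_near: "(\<Sum>i<n. \<bar>f \<theta> (x i) - f \<theta>' (x i)\<bar>) \<le> real n * (\<eta> / 2) * \<epsilon>"
        by (simp add: field_simps)
      have "(\<Sum>i<n. \<bar>H (\<theta>, t) (z i) - H (\<theta>', t') (z i)\<bar>) \<le> (\<Sum>i<n. \<bar>f \<theta> (x i) - f \<theta>' (x i)\<bar> / \<epsilon> + \<eta> / 2)"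
        by (rule sum_mono) (simp add: ptw)
      also have "\<dots> = (\<Sum>i<n. \<bar>f \<theta> (x i) - f \<theta>' (x i)\<bar>) / \<epsilon> + real n * (\<eta> / 2)"
        by (simp add: sum.distrib sum_divide_distrib)
      also have "\<dots> \<le> real n * (\<eta> / 2) + real n * (\<eta> / 2)"
        using f_near \<epsilon> by (intro add_right_mono) (simp add: pos_divide_le_eq)
      also have "\<dots> = real n * \<eta>" by simp
      finally have "(\<Sum>i<n. \<bar>h (z i) - H (rep (key (\<theta>, t))) (z i)\<bar>) \<le> real n * \<eta>"
        unfolding h rep_eq .
      moreover have "H (rep (key (\<theta>, t))) \<in> S" using mem by (auto simp: S_def)
      ultimately show "\<exists>g\<in>S. (\<Sum>i<n. \<bar>h (z i) - g (z i)\<bar>) \<le> real n * \<eta>" by blast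
    qed
  qed
  then show ?thesis
    by (intro exI[of _ "\<lambda>n. N * ((d + 1) * (n * (m + 2) + 1) ^ d)"] conjI allI impI ballI
        polynomial_times_exp_tendsto_0)
qed

text \<open>Putting the quantifier over \<open>t\<close> inside the event allows a random threshold
  to be substituted separately at each outcome. The limit is free of \<open>t\<close> by
  \<open>integral_HT_weighted\<close>.\<close>

lemma HT_objective_uniform_convergence:
  fixes f :: "'p \<Rightarrow> 'x \<Rightarrow> real" and \<Theta> :: "'p set" and \<T> :: "('x \<Rightarrow> real) set"
  assumes ne: "\<Theta> \<noteq> {}" "\<T> \<noteq> {}"
    and meas: "P_measurable_class joint_law {\<lambda>(x, r). f \<theta> x * HT_weight K t x r | \<theta> t. \<theta> \<in> \<Theta> \<and> t \<in> \<T>}"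
    and BUEI: "BUEI_class (space P) (f ` \<Theta>)" and VC: "VC_dim_fun (space P) \<T> < \<infinity>"
    and \<epsilon>: "\<epsilon> > 0" and cdf: "\<And>t x. t \<in> \<T> \<Longrightarrow> x \<in> space P \<Longrightarrow> cond_cdf K (t x) x > \<epsilon>"
    and B: "B > 0" "\<And>\<theta> x. \<theta> \<in> \<Theta> \<Longrightarrow> x \<in> space P \<Longrightarrow> \<bar>f \<theta> x\<bar> \<le> B"
    and \<delta>: "\<delta> > 0"
  shows "(\<lambda>n. outer_prob M {\<omega> \<in> space M. \<exists>\<theta>\<in>\<Theta>. \<exists>t\<in>\<T>.
    \<bar>HT_objective X R K f n \<theta> t \<omega> - limit_objective P f \<theta>\<bar> > \<delta>}) \<longlonglongrightarrow> 0"
proof -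
  let ?\<H> = "{\<lambda>(x, r). f \<theta> x * HT_weight K t x r | \<theta> t. \<theta> \<in> \<Theta> \<and> t \<in> \<T>}"
  have bound: "\<bar>f \<theta> x * HT_weight K t x r\<bar> \<le> B / \<epsilon>" if "\<theta> \<in> \<Theta>" "t \<in> \<T>" "x \<in> space P" for \<theta> t x r
  proof -
    have "\<bar>HT_weight K t x r\<bar> \<le> 1 / \<epsilon>"
      using cdf[OF that(2,3)] \<epsilon> by (auto simp: HT_weight_def intro!: divide_left_mono)
    then have "\<bar>f \<theta> x\<bar> * \<bar>HT_weight K t x r\<bar> \<le> B * (1 / \<epsilon>)"
      using B(2)[OF that(1,3)] B(1) by (intro mult_mono) auto
    then show ?thesis by (simp add: abs_mult)
  qed
  have expect: "(\<integral>z. (case z of (x, r) \<Rightarrow> f \<theta> x * HT_weight K t x r) \<partial>joint_law) = limit_objective P f \<theta>"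
    if "\<theta> \<in> \<Theta>" "t \<in> \<T>" for \<theta> t
    unfolding limit_objective_def
  proof (rule integral_HT_weighted)
    show "(\<lambda>(x, r). f \<theta> x * HT_weight K t x r) \<in> borel_measurable joint_law"
      using meas that unfolding P_measurable_class_def by blast
    show "\<bar>f \<theta> x * HT_weight K t x r\<bar> \<le> B / \<epsilon>" if "x \<in> space P" for x r
      using bound \<open>\<theta> \<in> \<Theta>\<close> \<open>t \<in> \<T>\<close> that by blast
    show "0 < cond_cdf K (t x) x" if "x \<in> space P" for x
      using cdf[OF \<open>t \<in> \<T>\<close> that] \<epsilon> by linarith
  qed
  have "(\<lambda>n. outer_prob M {\<omega> \<in> space M. \<exists>h\<in>?\<H>.
      \<bar>(\<Sum>i<n. h (X i \<omega>, R i \<omega>)) / n - (\<integral>z. h z \<partial>joint_law)\<bar> > \<delta>}) \<longlonglongrightarrow> 0"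
  proof (rule glivenko_cantelli[OF sample_prob_space sample_indep _ _ meas _ _ _ \<delta>])
    show "distr M (P \<Otimes>\<^sub>M borel) (\<lambda>\<omega>. (X i \<omega>, R i \<omega>)) = joint_law" for i
      by (simp add: distr_sample_eq_kernel_law)
    show "?\<H> \<noteq> {}" using ne by blast
    show "B / \<epsilon> > 0" using B \<epsilon> by simp
    show "\<bar>h z\<bar> \<le> B / \<epsilon>" if "h \<in> ?\<H>" "z \<in> space joint_law" for h z
      using that bound by (auto simp: space_pair_measure)
  qed (use ne(1) BUEI VC \<epsilon> cdf B in
      \<open>rule HT_class_cover[where f = f and \<Theta> = \<Theta> and \<T> = \<T> and \<epsilon> = \<epsilon> and B = B]\<close>)
  moreover have "(\<exists>h\<in>?\<H>. \<bar>(\<Sum>i<n. h (X i \<omega>, R i \<omega>)) / n - (\<integral>z. h z \<partial>joint_law)\<bar> > \<delta>) \<longleftrightarrow>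
      (\<exists>\<theta>\<in>\<Theta>. \<exists>t\<in>\<T>. \<bar>HT_objective X R K f n \<theta> t \<omega> - limit_objective P f \<theta>\<bar> > \<delta>)" for n \<omega>
  proof -
    have "(\<exists>h\<in>?\<H>. Q h) \<longleftrightarrow> (\<exists>\<theta>\<in>\<Theta>. \<exists>t\<in>\<T>. Q (\<lambda>(x, r). f \<theta> x * HT_weight K t x r))" for Q by blast
    then show ?thesis by (simp add: expect HT_objective_def emp_mean_def cong: bex_cong)
  qed
  ultimately show ?thesis by simp
qed

end

section \<open>The argmax argument\<close>

text \<open>If no gap worked, the tolerances \<open>1 / Suc n\<close> would yield parameters with
  \<open>J\<close> approaching at least \<open>J \<theta>\<^sub>0\<close> but staying farther than
  \<open>\<delta>\<close> away, against the sequential condition.\<close>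

lemma well_separated_maximum:
  fixes J :: "'p \<Rightarrow> real" and d :: "'p \<Rightarrow> 'p \<Rightarrow> real"
  assumes sep: "\<And>\<theta>s :: nat \<Rightarrow> 'p. range \<theta>s \<subseteq> \<Theta> \<Longrightarrow>
      liminf (\<lambda>n. ereal (J (\<theta>s n))) \<ge> ereal (J \<theta>\<^sub>0) \<Longrightarrow> (\<lambda>n. d (\<theta>s n) \<theta>\<^sub>0) \<longlonglongrightarrow> 0"
    and \<delta>: "\<delta> > 0"
  obtains \<eta> where "\<eta> > 0" "\<And>\<theta>. \<theta> \<in> \<Theta> \<Longrightarrow> J \<theta> \<ge> J \<theta>\<^sub>0 - \<eta> \<Longrightarrow> d \<theta> \<theta>\<^sub>0 \<le> \<delta>"
proof (rule ccontr)
  assume "\<not> thesis"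
  have "\<exists>\<theta>\<in>\<Theta>. J \<theta> \<ge> J \<theta>\<^sub>0 - 1 / Suc n \<and> d \<theta> \<theta>\<^sub>0 > \<delta>" for n
  proof (rule ccontr)
    assume "\<not> ?thesis"
    then have le: "d \<theta> \<theta>\<^sub>0 \<le> \<delta>" if "\<theta> \<in> \<Theta>" "J \<theta> \<ge> J \<theta>\<^sub>0 - 1 / Suc n" for \<theta>
      using that by (auto simp: not_less)
    have thesis by (rule that[of "1 / real (Suc n)"]) (simp, rule le)
    then show False using \<open>\<not> thesis\<close> by contradiction
  qed
  then obtain \<theta>s where s: "\<And>n. \<theta>s n \<in> \<Theta>" "\<And>n. J (\<theta>s n) \<ge> J \<theta>\<^sub>0 - 1 / Suc n" "\<And>n. d (\<theta>s n) \<theta>\<^sub>0 > \<delta>"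
    by metis
  have "(\<lambda>n. J \<theta>\<^sub>0 - 1 / Suc n) \<longlonglongrightarrow> J \<theta>\<^sub>0" by real_asymp
  then have "liminf (\<lambda>n. ereal (J \<theta>\<^sub>0 - 1 / Suc n)) = ereal (J \<theta>\<^sub>0)"
    by (intro lim_imp_Liminf) auto
  moreover have "liminf (\<lambda>n. ereal (J \<theta>\<^sub>0 - 1 / Suc n)) \<le> liminf (\<lambda>n. ereal (J (\<theta>s n)))"
    using s(2) by (intro Liminf_mono always_eventually) auto
  ultimately have "(\<lambda>n. d (\<theta>s n) \<theta>\<^sub>0) \<longlonglongrightarrow> 0" using s(1) by (intro sep) auto
  then have "\<forall>\<^sub>F n in sequentially. d (\<theta>s n) \<theta>\<^sub>0 < \<delta>" using \<delta> by (rule order_tendstoD)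
  then obtain n where "d (\<theta>s n) \<theta>\<^sub>0 < \<delta>" by (auto simp: eventually_sequentially)
  with s(3)[of n] show False by simp
qed

theorem theorem10:
  fixes M :: "'w measure" and P :: "'x measure" and K :: "'x \<Rightarrow> real measure"
    and X :: "nat \<Rightarrow> 'w \<Rightarrow> 'x" and R :: "nat \<Rightarrow> 'w \<Rightarrow> real"
    and \<Theta> :: "'p set" and d :: "'p \<Rightarrow> 'p \<Rightarrow> real" and \<theta>\<^sub>0 :: 'p
    and f :: "'p \<Rightarrow> 'x \<Rightarrow> real" and \<T> :: "('x \<Rightarrow> real) set"
    and \<theta>hat \<theta>hatT :: "nat \<Rightarrow> 'w \<Rightarrow> 'p"
    and Tn :: "nat \<Rightarrow> 'w \<Rightarrow> 'x \<Rightarrow> real" and T :: "'w \<Rightarrow> 'x \<Rightarrow> real"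
    and c :: "nat \<Rightarrow> real" and c\<^sub>0 \<epsilon> :: real
  assumes sample: "iid_priority_sample M P K X R"
    and metric: "Metric_space \<Theta> d" and \<theta>\<^sub>0: "\<theta>\<^sub>0 \<in> \<Theta>"
    and f_measurable: "\<And>\<theta>. \<theta> \<in> \<Theta> \<Longrightarrow> f \<theta> \<in> borel_measurable P"
    and \<T>_measurable: "\<T> \<subseteq> borel_measurable P"
    and HT_class_measurable:
      "P_measurable_class (distr M (P \<Otimes>\<^sub>M borel) (\<lambda>\<omega>. (X 0 \<omega>, R 0 \<omega>)))
         {\<lambda>(x, r). f \<theta> x * HT_weight K t x r | \<theta> t. \<theta> \<in> \<Theta> \<and> t \<in> \<T>}"
    and well_separated:
      "\<And>\<theta>s :: nat \<Rightarrow> 'p. range \<theta>s \<subseteq> \<Theta> \<Longrightarrow>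
         liminf (\<lambda>n. ereal (limit_objective P f (\<theta>s n))) \<ge> ereal (limit_objective P f \<theta>\<^sub>0) \<Longrightarrow>
         (\<lambda>n. d (\<theta>s n) \<theta>\<^sub>0) \<longlonglongrightarrow> 0"
    and uniform_convergence:
      "tendsto_outer_prob M
         (\<lambda>n \<omega>. SUP \<theta>\<in>\<Theta>. \<bar>emp_objective X R f n \<theta> \<omega> - limit_objective P f \<theta>\<bar>) (\<lambda>_. 0)"
    and \<theta>hat: "\<And>n \<omega>. \<omega> \<in> space M \<Longrightarrow> \<theta>hat n \<omega> \<in> \<Theta>"
    and \<theta>hat_near_max:
      "tendsto_outer_prob M
         (\<lambda>n \<omega>. (SUP \<theta>\<in>\<Theta>. emp_objective X R f n \<theta> \<omega>) - emp_objective X R f n (\<theta>hat n \<omega>) \<omega>)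
         (\<lambda>_. 0)"
    and c_lim: "c \<longlonglongrightarrow> c\<^sub>0" and c\<^sub>0_nonneg: "c\<^sub>0 \<ge> 0"
    and c_n_infinity: "filterlim (\<lambda>n. c n * real n) at_top sequentially"
    and Tn: "\<And>n \<omega>. \<omega> \<in> space M \<Longrightarrow> Tn n \<omega> \<in> \<T>"
    and Tn_lim:
      "\<And>x. x \<in> space P \<Longrightarrow> tendsto_outer_prob M (\<lambda>n \<omega>. c n * Tn n \<omega> x) (\<lambda>\<omega>. T \<omega> x)"
    and BUEI: "BUEI_class (space P) (f ` \<Theta>)"
    and VC: "VC_dim_fun (space P) \<T> < \<infinity>"
    and \<epsilon>_pos: "\<epsilon> > 0"
    and cdf_lower_bound: "\<And>t x. t \<in> \<T> \<Longrightarrow> x \<in> space P \<Longrightarrow> cond_cdf K (t x) x > \<epsilon>"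
    and f_bounded: "uniformly_bounded (space P) (f ` \<Theta>)"
    and \<T>_bounded: "uniformly_bounded (space P) \<T>"
    and \<theta>hatT: "\<And>n \<omega>. \<omega> \<in> space M \<Longrightarrow> \<theta>hatT n \<omega> \<in> \<Theta>"
    and \<theta>hatT_near_max:
      "tendsto_outer_prob M
         (\<lambda>n \<omega>. (SUP \<theta>\<in>\<Theta>. HT_objective X R K f n \<theta> (Tn n \<omega>) \<omega>)
                  - HT_objective X R K f n (\<theta>hatT n \<omega>) (Tn n \<omega>) \<omega>)
         (\<lambda>_. 0)"
  shows "tendsto_outer_prob M (\<lambda>n \<omega>. d (\<theta>hatT n \<omega>) \<theta>\<^sub>0) (\<lambda>_. 0)"
proof -
  interpret M: prob_space M by (rule sample_prob_space[OF sample])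
  interpret Metric_space \<Theta> d by (rule metric)
  obtain \<omega>\<^sub>0 where "\<omega>\<^sub>0 \<in> space M" using M.not_empty by blast
  then have ne: "\<Theta> \<noteq> {}" "\<T> \<noteq> {}" using \<theta>\<^sub>0 Tn by blast+
  obtain B0 where B0: "\<And>\<theta> x. \<theta> \<in> \<Theta> \<Longrightarrow> x \<in> space P \<Longrightarrow> \<bar>f \<theta> x\<bar> \<le> B0"
    using f_bounded by (auto simp: uniformly_bounded_def)
  \<comment> \<open>The maximum with 1 makes the bound strictly positive, as is required where it is
    divided by or used as a scale.\<close>
  define B where "B = max B0 1"
  have B: "B > 0" "\<And>\<theta> x. \<theta> \<in> \<Theta> \<Longrightarrow> x \<in> space P \<Longrightarrow> \<bar>f \<theta> x\<bar> \<le> B"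
    using B0 by (force simp: B_def)+
  let ?J = "limit_objective P f"
  show ?thesis
    unfolding tendsto_outer_prob_def
  proof (intro allI impI)
    fix \<delta> :: real assume "\<delta> > 0"
    then obtain \<eta> where \<eta>: "\<eta> > 0" and sep: "\<And>\<theta>. \<theta> \<in> \<Theta> \<Longrightarrow> ?J \<theta> \<ge> ?J \<theta>\<^sub>0 - \<eta> \<Longrightarrow> d \<theta> \<theta>\<^sub>0 \<le> \<delta>"
      using well_separated_maximum[of \<Theta> ?J \<theta>\<^sub>0 d \<delta>] well_separated by blast
    \<comment> \<open>Three errors separate the limit objective at the estimator from its value at
      \<open>\<theta>\<^sub>0\<close>: the deviation at each of the two parameters and the slack in
      the near-maximization. Each gets \<open>\<eta> / 3\<close>.\<close>
    let ?D = "\<lambda>n. {\<omega> \<in> space M. \<exists>\<theta>\<in>\<Theta>. \<exists>t\<in>\<T>. \<bar>HT_objective X R K f n \<theta> t \<omega> - ?J \<theta>\<bar> > \<eta> / 3}"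
    let ?G = "\<lambda>n. {\<omega> \<in> space M. \<bar>(SUP \<theta>\<in>\<Theta>. HT_objective X R K f n \<theta> (Tn n \<omega>) \<omega>)
        - HT_objective X R K f n (\<theta>hatT n \<omega>) (Tn n \<omega>) \<omega> - 0\<bar> > \<eta> / 3}"
    let ?E = "\<lambda>n. {\<omega> \<in> space M. \<bar>d (\<theta>hatT n \<omega>) \<theta>\<^sub>0 - 0\<bar> > \<delta>}"
    have \<eta>3: "\<eta> / 3 > 0" using \<eta> by simp
    have D: "(\<lambda>n. outer_prob M (?D n)) \<longlonglongrightarrow> 0"
      by (rule HT_objective_uniform_convergence[where \<epsilon> = \<epsilon> and B = B]) fact+
    have G: "(\<lambda>n. outer_prob M (?G n)) \<longlonglongrightarrow> 0"
      using \<theta>hatT_near_max \<eta>3 unfolding tendsto_outer_prob_def by blast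
    have sub: "?E n \<subseteq> ?D n \<union> ?G n" for n
    proof
      fix \<omega> assume \<omega>: "\<omega> \<in> ?E n"
      then have \<omega>M: "\<omega> \<in> space M" by simp
      show "\<omega> \<in> ?D n \<union> ?G n"
      proof (rule ccontr)
        assume not: "\<omega> \<notin> ?D n \<union> ?G n"
        let ?H = "\<lambda>\<theta>. HT_objective X R K f n \<theta> (Tn n \<omega>) \<omega>"
        have dev: "\<bar>?H \<theta> - ?J \<theta>\<bar> \<le> \<eta> / 3" if "\<theta> \<in> \<Theta>" for \<theta>
          using not that Tn[OF \<omega>M, of n] \<omega>M by (auto simp: not_less)
        have gap: "(SUP \<theta>\<in>\<Theta>. ?H \<theta>) - ?H (\<theta>hatT n \<omega>) \<le> \<eta> / 3"
        proof -
          have "\<bar>(SUP \<theta>\<in>\<Theta>. ?H \<theta>) - ?H (\<theta>hatT n \<omega>) - 0\<bar> \<le> \<eta> / 3"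
            using not \<omega>M by (auto simp: not_less)
          then show ?thesis by linarith
        qed
        \<comment> \<open>A real \<open>SUP\<close> dominates its members only if the set is bounded
          above; outside \<open>?D n\<close> this follows from a bound on the limit
          objective.\<close>
        have J_le: "?J \<theta> \<le> B" if "\<theta> \<in> \<Theta>" for \<theta>
        proof -
          interpret P: prob_space P by (rule prob_space_P[OF sample])
          have "?J \<theta> \<le> (\<integral>x. B \<partial>P)"
            unfolding limit_objective_def using B(2)[OF that] f_measurable[OF that] B(1)
            by (intro integral_mono P.integrable_const_bound[of _ B]) (auto simp: abs_le_iff)
          then show ?thesis by (simp add: P.prob_space)
        qed
        have "?H \<theta>\<^sub>0 \<le> (SUP \<theta>\<in>\<Theta>. ?H \<theta>)"
        proof (rule cSUP_upper[OF \<theta>\<^sub>0])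
          show "bdd_above (?H ` \<Theta>)"
          proof (rule bdd_aboveI2)
            show "?H \<theta> \<le> B + \<eta> / 3" if "\<theta> \<in> \<Theta>" for \<theta>
              using dev[OF that] J_le[OF that] by linarith
          qed
        qed
        then have "?J (\<theta>hatT n \<omega>) \<ge> ?J \<theta>\<^sub>0 - \<eta>"
          using dev[OF \<theta>\<^sub>0] dev[OF \<theta>hatT[OF \<omega>M, of n]] gap unfolding abs_le_iff by linarith
        then have "d (\<theta>hatT n \<omega>) \<theta>\<^sub>0 \<le> \<delta>" by (rule sep[OF \<theta>hatT[OF \<omega>M]])
        with \<omega> show False by simp
      qed
    qed
    have le: "outer_prob M (?E n) \<le> outer_prob M (?D n) + outer_prob M (?G n)" for n
      by (rule order_trans[OF M.outer_prob_mono[OF sub] M.outer_prob_Un_le]) auto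
    have "(\<lambda>n. outer_prob M (?D n) + outer_prob M (?G n)) \<longlonglongrightarrow> 0"
      using tendsto_add[OF D G] by simp
    then show "(\<lambda>n. outer_prob M (?E n)) \<longlonglongrightarrow> 0"
    proof (rule tendsto_sandwich[rotated -1])
      show "(\<lambda>_. 0) \<longlonglongrightarrow> (0 :: real)" by simp
      show "\<forall>\<^sub>F n in sequentially. 0 \<le> outer_prob M (?E n)"
        by (intro always_eventually allI M.outer_prob_nonneg) auto
    qed (use le in \<open>auto intro: always_eventually\<close>)
  qed
qed

end
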